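(* Let $k$ be a field and let $\Delta$ be a simplicial complex on the vertex set $\{x_1,\ldots,x_n\}$ which is a tree. Let $R=k[x_1,\ldots,x_n]$, localized at the maximal ideal $(x_1,\ldots,x_n)$, so that $\dim R=n$. Then the facet ideal $\mathcal{F}(\Delta)$ satisfies sliding depth in $R$: if $\mathcal{F}(\Delta)=(M_1,\ldots,M_q)$, where $M_1,\ldots,M_q$ are the square-free monomials corresponding to the $q$ facets of $\Delta$, and $\mathbb{K}$ is the Koszul complex of $M_1,\ldots,M_q$ over $R$ with homology modules $H_i(\mathbb{K})$, then $$\operatorname{depth} H_i(\mathbb{K})\ \ge\ n-q+i\quad\text{for all } i.$$
   Context: A simplicial complex $\Delta$ on a vertex set $V$ is a collection of subsets of $V$ containing every singleton $\{v\}$, $v\in V$, and closed under taking subsets. Its facets are its maximal faces under inclusion. We identify each vertex $x_j$ with the variable $x_j$ of the polynomial ring. The facet ideal $\mathcal{F}(\Delta)$ is the ideal of $k[x_1,\ldots,x_n]$ generated by the square-free monomials $\prod_{x_j\in F}x_j$, one for each facet $F$ of $\Delta$. A subcomplex of $\Delta$ is a simplicial complex whose set of facets is a subset of the set of facets of $\Delta$. $\Delta$ is connected if for any two facets $F,F'$ there is a sequence of facets $F=F_0,F_1,\ldots,F_m=F'$ with $F_{j}\cap F_{j+1}\neq\emptyset$ for all $j$. A facet $F$ of $\Delta$ is a leaf of $\Delta$ if either $F$ is the only facet of $\Delta$, or there is a facet $G\ne F$ of $\Delta$ such that $F\cap F'\subseteq F\cap G$ for every facet $F'\neq F$ of $\Delta$.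 A connected simplicial complex $\Delta$ is a tree if every nonempty subcomplex of $\Delta$ (including $\Delta$ itself) has a leaf. *)

theory Defs
  imports Main "HOL-Library.Poly_Mapping"
begin

text \<open>Polynomials over a field 'k in the variables x_0, x_1, ... (exponent vectors nat =>0 nat).
  The vertex x_j of the paper (j = 1..n) is the variable with index j-1 here.\<close>
type_synonym 'k pl = "(nat \<Rightarrow>\<^sub>0 nat) \<Rightarrow>\<^sub>0 'k"

definition inPn :: "nat \<Rightarrow> 'k::field pl \<Rightarrow> bool" where
  "inPn n p \<longleftrightarrow> (\<forall>m\<in>Poly_Mapping.keys p. Poly_Mapping.keys m \<subseteq> {..<n})"

text \<open>p is a unit of the localization at the maximal ideal (x_0,...,x_(n-1)):
  nonzero constant term.\<close>
definition unit_at0 :: "'k::field pl \<Rightarrow> bool" where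
  "unit_at0 p \<longleftrightarrow> Poly_Mapping.lookup p 0 \<noteq> 0"

definition facet_monomial :: "nat set \<Rightarrow> 'k::field pl" where
  "facet_monomial A = Poly_Mapping.single (\<Sum>v\<in>A. Poly_Mapping.single v 1) 1"

text \<open>Chains of degree i: R-linear combinations of the basis e_T, T an i-subset of {0..<q}.\<close>
definition chains :: "nat \<Rightarrow> nat \<Rightarrow> nat \<Rightarrow> (nat set \<Rightarrow> 'k::field pl) set" where
  "chains n q i = {v. (\<forall>T. v T \<noteq> 0 \<longrightarrow> T \<subseteq> {..<q} \<and> card T = i) \<and> (\<forall>T. inPn n (v T))}"

text \<open>Koszul differential, d(e_S) = sum over j in S of (-1)^(number of l in S with l<j) M_j e_(S-{j}).\<close>
definition koszul_d :: "(nat \<Rightarrow> 'k::field pl) \<Rightarrow> nat \<Rightarrow> (nat set \<Rightarrow> 'k pl) \<Rightarrow> (nat set \<Rightarrow> 'k pl)" where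
  "koszul_d M q v = (\<lambda>T. \<Sum>j\<in>{..<q} - T. (-1) ^ card {l\<in>T. l < j} * M j * v (insert j T))"

definition cycles :: "nat \<Rightarrow> (nat \<Rightarrow> 'k::field pl) \<Rightarrow> nat \<Rightarrow> nat \<Rightarrow> (nat set \<Rightarrow> 'k pl) set" where
  "cycles n M q i = {v \<in> chains n q i. koszul_d M q v = (\<lambda>_. 0)}"

definition boundaries :: "nat \<Rightarrow> (nat \<Rightarrow> 'k::field pl) \<Rightarrow> nat \<Rightarrow> nat \<Rightarrow> (nat set \<Rightarrow> 'k pl) set" where
  "boundaries n M q i = koszul_d M q ` chains n q (Suc i)"

text \<open>Saturation of a submodule L of N: the preimage in N of the localization L_m.\<close>
definition sat :: "nat \<Rightarrow> (nat set \<Rightarrow> 'k::field pl) set \<Rightarrow> (nat set \<Rightarrow> 'k pl) set \<Rightarrow> (nat set \<Rightarrow> 'k pl) set" where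
  "sat n N L = {v \<in> N. \<exists>s. inPn n s \<and> unit_at0 s \<and> (\<lambda>T. s * v T) \<in> L}"

definition gen_sub :: "(nat set \<Rightarrow> 'k::field pl) set \<Rightarrow> (nat set \<Rightarrow> 'k pl) set \<Rightarrow> 'k pl list \<Rightarrow> (nat set \<Rightarrow> 'k pl) set" where
  "gen_sub N L rs = {(\<lambda>T. l T + (\<Sum>j<length rs. rs ! j * w j T)) | l w. l \<in> L \<and> (\<forall>j<length rs. w j \<in> N)}"

text \<open>rs is a regular sequence (in the maximal ideal) on the localized module (N/L)_m.\<close>
definition regular_seq :: "nat \<Rightarrow> (nat set \<Rightarrow> 'k::field pl) set \<Rightarrow> (nat set \<Rightarrow> 'k pl) set \<Rightarrow> 'k pl list \<Rightarrow> bool" where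
  "regular_seq n N L rs \<longleftrightarrow>
     (\<forall>j<length rs. inPn n (rs ! j) \<and> Poly_Mapping.lookup (rs ! j) 0 = 0) \<and>
     (\<forall>j<length rs. \<forall>v\<in>N. (\<lambda>T. rs ! j * v T) \<in> sat n N (gen_sub N L (take j rs))
                         \<longrightarrow> v \<in> sat n N (gen_sub N L (take j rs))) \<and>
     sat n N (gen_sub N L rs) \<noteq> N"

text \<open>depth (N/L)_m >= d  (the zero module has depth infinity).\<close>
definition depth_ge :: "nat \<Rightarrow> (nat set \<Rightarrow> 'k::field pl) set \<Rightarrow> (nat set \<Rightarrow> 'k pl) set \<Rightarrow> nat \<Rightarrow> bool" where
  "depth_ge n N L d \<longleftrightarrow> sat n N L = N \<or> (\<exists>rs. length rs = d \<and> regular_seq n N L rs)"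

definition facet_set :: "nat \<Rightarrow> nat set set \<Rightarrow> bool" where
  "facet_set n F \<longleftrightarrow> (\<forall>A\<in>F. A \<noteq> {} \<and> A \<subseteq> {..<n}) \<and> (\<forall>A\<in>F. \<forall>B\<in>F. A \<subseteq> B \<longrightarrow> A = B)
      \<and> \<Union>F = {..<n}"

definition is_leaf :: "nat set set \<Rightarrow> nat set \<Rightarrow> bool" where
  "is_leaf G A \<longleftrightarrow> A \<in> G \<and> (G = {A} \<or> (\<exists>B\<in>G. B \<noteq> A \<and> (\<forall>C\<in>G. C \<noteq> A \<longrightarrow> A \<inter> C \<subseteq> A \<inter> B)))"

definition connected_cx :: "nat set set \<Rightarrow> bool" where
  "connected_cx F \<longleftrightarrow> (\<forall>A\<in>F. \<forall>B\<in>F. (\<lambda>X Y. X \<in> F \<and> Y \<in> F \<and> X \<inter> Y \<noteq> {})\<^sup>*\<^sup>* A B)"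

definition is_tree :: "nat set set \<Rightarrow> bool" where
  "is_tree F \<longleftrightarrow> connected_cx F \<and> (\<forall>G. G \<subseteq> F \<and> G \<noteq> {} \<longrightarrow> (\<exists>A. is_leaf G A))"

end

theory Submission
  imports Defs HOL.Modules "HOL-Library.Function_Algebras"
begin

text \<open>
  Work with indexed families \<open>A j\<close> (\<open>j \<in> I\<close>) of vertex sets, possibly nested or equal, all of whose
  nonempty subfamilies have a leaf. The Koszul homology \<open>H i\<close> of the monomials \<open>x\<^bsub>A j\<^esub>\<close> has a finite
  filtration whose quotients are cyclic modules \<open>R / (x\<^sub>v : v \<in> S)\<close> with \<open>card S + i \<le> card I\<close>.
  This goes by induction. If \<open>A j \<subseteq> A g\<close>, the monomial of \<open>A g\<close> kills the homology without \<open>g\<close>, so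
  \<open>H i\<close> is an extension of \<open>H (i - 1)\<close> by \<open>H i\<close> of the family without \<open>g\<close>. If \<open>w \<in> A j\<close> lies in
  no other member, then \<open>x\<^sub>w\<close> is regular on the homology \<open>H'\<close> of the family without \<open>j\<close>, and multiplying
  the components without \<open>e\<^sub>j\<close> by \<open>x\<^sub>w\<close> embeds \<open>H i\<close> of the family with \<open>A j - {w}\<close> in place of \<open>A j\<close>
  into \<open>H i\<close>, with cokernel \<open>H' i / x\<^sub>w H' i\<close>. A leaf always provides one of the two situations, or is
  a single empty set, whose monomial \<open>1\<close> has no homology.

  The elementary symmetric polynomials \<open>e\<^sub>1, \<dots>, e\<^sub>d\<close> are regular on \<open>R / (x\<^sub>v : v \<in> S)\<close> whenever
  \<open>d + card S \<le> n\<close>, hence on every module filtered in this way: homogeneous regular sequences can be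
  permuted, so by induction each remaining variable is regular modulo \<open>e\<^sub>1, \<dots>, e\<^bsub>d - 1\<^esub>\<close>, and
  \<open>e\<^sub>d\<close> is the product of the remaining variables when \<open>d + card S = n\<close>.
\<close>

section \<open>Regular sequences and filtrations with cyclic quotients\<close>

text \<open>Modules are subsets of an ambient type, because the polynomials in the first
  \<open>n\<close> variables form only a subset \<open>R\<close> of the type of scalars. The scalar
  multiplication is a parameter so that ideals and modules of chains share one theory.\<close>

definition subm :: "('a \<Rightarrow> 'm \<Rightarrow> 'm::ab_group_add) \<Rightarrow> 'a set \<Rightarrow> 'm set \<Rightarrow> bool" where
  "subm s R N \<longleftrightarrow> 0 \<in> N \<and> (\<forall>u\<in>N. \<forall>v\<in>N. u + v \<in> N) \<and> (\<forall>p\<in>R. \<forall>v\<in>N. s p v \<in> N)"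

definition addm :: "('a \<Rightarrow> 'm \<Rightarrow> 'm::ab_group_add) \<Rightarrow> 'm set \<Rightarrow> 'a \<Rightarrow> 'm set \<Rightarrow> 'm set" where
  "addm s L r N = {l + s r v | l v. l \<in> L \<and> v \<in> N}"

text \<open>That \<open>r\<close> is a nonzerodivisor on \<open>N / (N \<inter> L)\<close>;
  \<open>L\<close> may fail to lie in \<open>N\<close>.\<close>

definition regular_on :: "('a \<Rightarrow> 'm \<Rightarrow> 'm) \<Rightarrow> 'm set \<Rightarrow> 'm set \<Rightarrow> 'a \<Rightarrow> bool" where
  "regular_on s N L r \<longleftrightarrow> (\<forall>v\<in>N. s r v \<in> L \<longrightarrow> v \<in> L)"

text \<open>Weak, since the quotient by the whole sequence may vanish; nonvanishing is shown
  separately when the depth is bounded.\<close>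

primrec weakly_regular ::
  "('a \<Rightarrow> 'm \<Rightarrow> 'm::ab_group_add) \<Rightarrow> 'm set \<Rightarrow> 'm set \<Rightarrow> 'a list \<Rightarrow> bool" where
  "weakly_regular s N L [] = True"
| "weakly_regular s N L (r # rs) =
    (regular_on s N L r \<and> weakly_regular s N (addm s L r N) rs)"

primrec addms ::
  "('a \<Rightarrow> 'm \<Rightarrow> 'm::ab_group_add) \<Rightarrow> 'm set \<Rightarrow> 'm set \<Rightarrow> 'a list \<Rightarrow> 'm set" where
  "addms s N L [] = L"
| "addms s N L (r # rs) = addms s N (addm s L r N) rs"

definition cyc :: "('a \<Rightarrow> 'm \<Rightarrow> 'm::ab_group_add) \<Rightarrow> 'a set \<Rightarrow> 'm set \<Rightarrow> 'm \<Rightarrow> 'm set" where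
  "cyc s R K z = {k + s p z | k p. k \<in> K \<and> p \<in> R}"

text \<open>In \<open>filtered s R \<J> L N\<close> the filtered module is \<open>N / L\<close>, and the annihilators of its cyclic
  quotients lie in \<open>\<J>\<close>.\<close>

inductive filtered ::
  "('a \<Rightarrow> 'm \<Rightarrow> 'm::ab_group_add) \<Rightarrow> 'a set \<Rightarrow> 'a set set \<Rightarrow> 'm set \<Rightarrow> 'm set \<Rightarrow> bool"
  for s R \<J> L where
  filtered_refl: "filtered s R \<J> L L"
| filtered_step: "filtered s R \<J> L K \<Longrightarrow> {p \<in> R. s p z \<in> K} \<in> \<J> \<Longrightarrow> filtered s R \<J> L (cyc s R K z)"

lemma filtered_stepI:
  assumes "filtered s R \<J> L K" "{p \<in> R. s p z \<in> K} = J" "J \<in> \<J>" "N = cyc s R K z"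
  shows "filtered s R \<J> L N"
  using filtered_step[of s R \<J> L K z] assms by simp

lemma filtered_trans:
  assumes "filtered s R \<J> K N" "filtered s R \<J> L K"
  shows "filtered s R \<J> L N"
  using assms by induction (auto intro: filtered.intros)

lemma filtered_mono:
  assumes "filtered s R \<J> L N" "\<J> \<subseteq> \<J>'"
  shows "filtered s R \<J>' L N"
  using assms by induction (auto intro: filtered.intros)

section \<open>Submodules over a subring of the scalars\<close>

locale subring_module = module scale
  for scale :: "'a::comm_ring_1 \<Rightarrow> 'm::ab_group_add \<Rightarrow> 'm" (infixr \<open>*s\<close> 75) +
  fixes R :: "'a set"
  assumes R_one: "1 \<in> R"
    and R_add: "p \<in> R \<Longrightarrow> r \<in> R \<Longrightarrow> p + r \<in> R"
    and R_mult: "p \<in> R \<Longrightarrow> r \<in> R \<Longrightarrow> p * r \<in> R"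
    and R_uminus: "p \<in> R \<Longrightarrow> - p \<in> R"
begin

lemma R_zero: "0 \<in> R"
  using R_add[OF R_one R_uminus[OF R_one]] by simp

lemma R_diff: "p \<in> R \<Longrightarrow> r \<in> R \<Longrightarrow> p - r \<in> R"
  using R_add[of p "- r"] R_uminus by simp

lemma subm_zero: "subm scale R N \<Longrightarrow> 0 \<in> N"
  and subm_add: "subm scale R N \<Longrightarrow> u \<in> N \<Longrightarrow> v \<in> N \<Longrightarrow> u + v \<in> N"
  and subm_scale: "subm scale R N \<Longrightarrow> p \<in> R \<Longrightarrow> v \<in> N \<Longrightarrow> p *s v \<in> N"
  by (auto simp: subm_def)

lemma subm_uminus: "subm scale R N \<Longrightarrow> v \<in> N \<Longrightarrow> - v \<in> N"
  using subm_scale[of N "- 1" v] R_uminus[OF R_one] by simp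

lemma subm_diff: "subm scale R N \<Longrightarrow> u \<in> N \<Longrightarrow> v \<in> N \<Longrightarrow> u - v \<in> N"
  using subm_add[of N u "- v"] subm_uminus by simp

lemma subm_sum: "subm scale R N \<Longrightarrow> (\<And>x. x \<in> X \<Longrightarrow> f x \<in> N) \<Longrightarrow> sum f X \<in> N"
  by (induction X rule: infinite_finite_induct) (auto simp: subm_zero subm_add)

lemma subm_cancel_left: "subm scale R N \<Longrightarrow> u + v \<in> N \<Longrightarrow> u \<in> N \<Longrightarrow> v \<in> N"
  using subm_diff[of N "u + v" u] by simp

lemma subm_addm:
  assumes "subm scale R L" "subm scale R N"
  shows "subm scale R (addm scale L r N)"
  unfolding subm_def
proof (intro conjI ballI)
  show "0 \<in> addm scale L r N"
    unfolding addm_def using assms[THEN subm_zero] by force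
  fix u assume u: "u \<in> addm scale L r N"
  then obtain l v where uv: "u = l + r *s v" "l \<in> L" "v \<in> N" by (auto simp: addm_def)
  {
    fix u' assume "u' \<in> addm scale L r N"
    then obtain l' v' where "u' = l' + r *s v'" "l' \<in> L" "v' \<in> N" by (auto simp: addm_def)
    with uv have "u + u' = (l + l') + r *s (v + v')" "l + l' \<in> L" "v + v' \<in> N"
      using assms by (auto simp: algebra_simps subm_add)
    then show "u + u' \<in> addm scale L r N" unfolding addm_def by blast
  }
  fix p assume "p \<in> R"
  then have "p *s u = p *s l + r *s (p *s v)" "p *s l \<in> L" "p *s v \<in> N"
    using uv assms by (auto simp: algebra_simps subm_scale)
  then show "p *s u \<in> addm scale L r N" unfolding addm_def by blast
qed

lemma addm_superset: "subm scale R N \<Longrightarrow> L \<subseteq> addm scale L r N"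
  unfolding addm_def using subm_zero by force

lemma scale_in_addm: "subm scale R L \<Longrightarrow> v \<in> N \<Longrightarrow> r *s v \<in> addm scale L r N"
  unfolding addm_def using subm_zero by force

lemma addm_subset: "subm scale R N \<Longrightarrow> L \<subseteq> N \<Longrightarrow> r \<in> R \<Longrightarrow> addm scale L r N \<subseteq> N"
  unfolding addm_def by (auto intro!: subm_add subm_scale)

lemma addm_mono: "N \<subseteq> N' \<Longrightarrow> addm scale L r N \<subseteq> addm scale L r N'"
  by (auto simp: addm_def)

lemma addm_commute:
  "addm scale (addm scale L r N) r' N = addm scale (addm scale L r' N) r N"
proof -
  have "addm scale (addm scale L r N) r' N \<subseteq> addm scale (addm scale L r' N) r N" for r r'
    unfolding addm_def by (force simp: ac_simps)
  then show ?thesis by blast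
qed

lemma subm_cyc:
  assumes "subm scale R K"
  shows "subm scale R (cyc scale R K z)"
  unfolding subm_def
proof (intro conjI ballI)
  have "0 = 0 + 0 *s z" by simp
  then show "0 \<in> cyc scale R K z"
    unfolding cyc_def using assms[THEN subm_zero] R_zero by blast
  fix u assume "u \<in> cyc scale R K z"
  then obtain k p where u: "u = k + p *s z" "k \<in> K" "p \<in> R" by (auto simp: cyc_def)
  {
    fix u' assume "u' \<in> cyc scale R K z"
    then obtain k' p' where "u' = k' + p' *s z" "k' \<in> K" "p' \<in> R" by (auto simp: cyc_def)
    with u have "u + u' = (k + k') + (p + p') *s z" "k + k' \<in> K" "p + p' \<in> R"
      using assms by (auto simp: algebra_simps subm_add R_add)
    then show "u + u' \<in> cyc scale R K z" unfolding cyc_def by blast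
  }
  fix r assume "r \<in> R"
  then have "r *s u = r *s k + (r * p) *s z" "r *s k \<in> K" "r * p \<in> R"
    using u assms by (auto simp: algebra_simps subm_scale R_mult)
  then show "r *s u \<in> cyc scale R K z" unfolding cyc_def by blast
qed

lemma cyc_superset: "K \<subseteq> cyc scale R K z"
proof
  fix k assume "k \<in> K"
  moreover have "k = k + 0 *s z" by simp
  ultimately show "k \<in> cyc scale R K z" unfolding cyc_def using R_zero by blast
qed

lemma cyc_generator: "subm scale R K \<Longrightarrow> z \<in> cyc scale R K z"
proof -
  assume "subm scale R K"
  moreover have "z = 0 + 1 *s z" by simp
  ultimately show ?thesis unfolding cyc_def using R_one subm_zero by blast
qed

lemma cyc_subset: "subm scale R N \<Longrightarrow> K \<subseteq> N \<Longrightarrow> z \<in> N \<Longrightarrow> cyc scale R K z \<subseteq> N"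
  unfolding cyc_def by (auto intro!: subm_add subm_scale)

lemma cyc_mono: "K \<subseteq> K' \<Longrightarrow> cyc scale R K z \<subseteq> cyc scale R K' z"
  by (auto simp: cyc_def)

lemma filtered_subset: "filtered scale R \<J> L N \<Longrightarrow> L \<subseteq> N"
  by (induction rule: filtered.induct) (use cyc_superset in auto)

lemma filtered_subm: "filtered scale R \<J> L N \<Longrightarrow> subm scale R L \<Longrightarrow> subm scale R N"
  by (induction rule: filtered.induct) (use subm_cyc in auto)

section \<open>Regular sequences on extensions and on cyclic modules\<close>

lemma regular_on_extension:
  assumes "subm scale R N" "subm scale R K" "r \<in> R" "L \<subseteq> K"
    and "regular_on scale K L r" "regular_on scale N K r"
  shows "regular_on scale N L r"
  using assms unfolding regular_on_def by blast

text \<open>\<open>(K + L) / L\<close> is isomorphic to \<open>K / (K \<inter> L)\<close>, so weak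
  regularity transfers.\<close>

lemma weakly_regular_quotient:
  assumes "subm scale R K" "subm scale R L" "set rs \<subseteq> R" "weakly_regular scale K (K \<inter> L) rs"
  shows "weakly_regular scale {k + l | k l. k \<in> K \<and> l \<in> L} L rs"
  using assms
proof (induction rs arbitrary: L)
  case Nil
  show ?case by simp
next
  case (Cons r rs)
  note K = Cons.prems(1) and L = Cons.prems(2)
  have r: "r \<in> R" using Cons.prems by simp
  let ?N = "{k + l | k l. k \<in> K \<and> l \<in> L}"
  let ?L' = "addm scale L r K"
  have "regular_on scale ?N L r"
    unfolding regular_on_def
  proof (intro ballI impI)
    fix v assume "v \<in> ?N" and rv: "r *s v \<in> L"
    then obtain k l where v: "v = k + l" "k \<in> K" "l \<in> L" by blast
    have "r *s l + r *s k \<in> L" using rv v by (simp add: algebra_simps)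
    then have "r *s k \<in> K \<inter> L"
      using v K L r subm_cancel_left[OF L, of "r *s l" "r *s k"] by (simp add: subm_scale)
    then have "k \<in> L" using Cons.prems(4) v by (auto simp: regular_on_def)
    then show "v \<in> L" using v L by (simp add: subm_add)
  qed
  moreover have "weakly_regular scale ?N (addm scale L r ?N) rs"
  proof -
    \<comment> \<open>Dividing by \<open>r\<close> replaces \<open>L\<close> by
      \<open>L + r K\<close> without changing \<open>K + L\<close>, and the modular law turns
      \<open>K \<inter> (L + r K)\<close> into \<open>(K \<inter> L) + r K\<close>; so the induction
      hypothesis applies to \<open>?L'\<close>.\<close>
    have 1: "addm scale L r ?N = ?L'"
    proof
      show "addm scale L r ?N \<subseteq> ?L'"
      proof
        fix u assume "u \<in> addm scale L r ?N"
        then obtain l k l' where "u = l + r *s (k + l')" "l \<in> L" "k \<in> K" "l' \<in> L"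
          by (auto simp: addm_def)
        then have "u = (l + r *s l') + r *s k" "l + r *s l' \<in> L" "k \<in> K"
          using L r by (auto simp: algebra_simps subm_add subm_scale)
        then show "u \<in> ?L'" unfolding addm_def by blast
      qed
      show "?L' \<subseteq> addm scale L r ?N"
      proof
        fix u assume "u \<in> ?L'"
        then obtain l k where "u = l + r *s (k + 0)" "l \<in> L" "k \<in> K" by (auto simp: addm_def)
        then show "u \<in> addm scale L r ?N" unfolding addm_def using subm_zero[OF L] by blast
      qed
    qed
    have 2: "?N = {k + l | k l. k \<in> K \<and> l \<in> ?L'}"
    proof
      show "?N \<subseteq> {k + l | k l. k \<in> K \<and> l \<in> ?L'}"
        using addm_superset[OF K, of L r] by blast
      show "{k + l | k l. k \<in> K \<and> l \<in> ?L'} \<subseteq> ?N"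
      proof clarify
        fix k l assume "k \<in> K" "l \<in> ?L'"
        then obtain l' k' where "l = l' + r *s k'" "l' \<in> L" "k' \<in> K" by (auto simp: addm_def)
        then have "k + l = (k + r *s k') + l'" "k + r *s k' \<in> K" "l' \<in> L"
          using K r \<open>k \<in> K\<close> by (auto simp: algebra_simps subm_add subm_scale)
        then show "\<exists>k' l'. k + l = k' + l' \<and> k' \<in> K \<and> l' \<in> L" by blast
      qed
    qed
    have 3: "K \<inter> ?L' = addm scale (K \<inter> L) r K"
    proof
      show "K \<inter> ?L' \<subseteq> addm scale (K \<inter> L) r K"
      proof clarify
        fix u assume "u \<in> K" "u \<in> ?L'"
        then obtain l k where u: "u = l + r *s k" "l \<in> L" "k \<in> K" by (auto simp: addm_def)
        then have "l = u - r *s k" by simp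
        then have "l \<in> K" using K u r \<open>u \<in> K\<close> by (metis subm_diff subm_scale)
        then show "u \<in> addm scale (K \<inter> L) r K" using u unfolding addm_def by blast
      qed
      show "addm scale (K \<inter> L) r K \<subseteq> K \<inter> ?L'"
        using addm_subset[OF K _ r, of "K \<inter> L"] unfolding addm_def by blast
    qed
    show ?thesis
      using Cons.IH[of ?L'] Cons.prems subm_addm[OF L K] by (simp add: 1 3 flip: 2)
  qed
  ultimately show ?case by simp
qed

text \<open>\<open>N / L\<close> is an extension of \<open>N / K\<close> by \<open>K / L\<close>.
  Dividing by the first element \<open>r\<close> leaves an extension of \<open>N / (K + r N)\<close>
  by \<open>K / (L + r K)\<close>, because \<open>r\<close> is a nonzerodivisor on
  \<open>N / K\<close>.\<close>

lemma weakly_regular_extension: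
  assumes "subm scale R N" "subm scale R K" "subm scale R L" "L \<subseteq> K" "K \<subseteq> N" "set rs \<subseteq> R"
    and "weakly_regular scale K L rs" "weakly_regular scale N K rs"
  shows "weakly_regular scale N L rs"
  using assms(2-)
proof (induction rs arbitrary: K L)
  case Nil
  show ?case by simp
next
  case (Cons r rs)
  note N = assms(1) and K = Cons.prems(1) and L = Cons.prems(2)
  have r: "r \<in> R" and reg: "regular_on scale K L r" "regular_on scale N K r"
    using Cons.prems by auto
  let ?K = "addm scale K r N" and ?L = "addm scale L r N"
  have K': "?K = {k + l | k l. k \<in> K \<and> l \<in> ?L}"
  proof
    show "?K \<subseteq> {k + l | k l. k \<in> K \<and> l \<in> ?L}"
    proof
      fix u assume "u \<in> ?K"
      then obtain k v where "u = k + r *s v" "k \<in> K" "v \<in> N" by (auto simp: addm_def)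
      then show "u \<in> {k + l | k l. k \<in> K \<and> l \<in> ?L}" using scale_in_addm[OF L, of v N r] by blast
    qed
    show "{k + l | k l. k \<in> K \<and> l \<in> ?L} \<subseteq> ?K"
    proof clarify
      fix k l assume "k \<in> K" "l \<in> ?L"
      then obtain l' v where "l = l' + r *s v" "l' \<in> L" "v \<in> N" by (auto simp: addm_def)
      then have "k + l = (k + l') + r *s v" "k + l' \<in> K" "v \<in> N"
        using K Cons.prems(3) \<open>k \<in> K\<close> by (auto simp: algebra_simps subm_add)
      then show "k + l \<in> ?K" unfolding addm_def by blast
    qed
  qed
  \<comment> \<open>Regularity on \<open>N / K\<close> enters here: \<open>K / (L + r K)\<close>
    embeds into \<open>N / (L + r N)\<close>, with image \<open>?K / ?L\<close>.\<close>
  have int: "K \<inter> ?L = addm scale L r K"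
  proof
    show "K \<inter> ?L \<subseteq> addm scale L r K"
    proof clarify
      fix u assume "u \<in> K" "u \<in> ?L"
      then obtain l v where u: "u = l + r *s v" "l \<in> L" "v \<in> N" by (auto simp: addm_def)
      then have "r *s v \<in> K"
        using K Cons.prems(3) \<open>u \<in> K\<close> subm_cancel_left[OF K, of l "r *s v"] by auto
      then have "v \<in> K" using reg(2) u by (auto simp: regular_on_def)
      then show "u \<in> addm scale L r K" using u unfolding addm_def by blast
    qed
    show "addm scale L r K \<subseteq> K \<inter> ?L"
      using addm_subset[OF K Cons.prems(3) r] addm_mono[OF Cons.prems(4)] by (intro Int_greatest)
  qed
  have "weakly_regular scale K (K \<inter> ?L) rs" using Cons.prems int by simp
  then have "weakly_regular scale ?K ?L rs"
    unfolding K' using Cons.prems(5)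
    by (intro weakly_regular_quotient subm_addm N K L) simp_all
  moreover have "?L \<subseteq> ?K" using Cons.prems(3) by (auto simp: addm_def)
  moreover have "?K \<subseteq> N" by (rule addm_subset[OF N Cons.prems(4) r])
  ultimately have "weakly_regular scale N ?L rs"
    using Cons.prems(5,7) by (auto intro: Cons.IH[OF subm_addm[OF K N, of r] subm_addm[OF L N, of r]])
  moreover have "regular_on scale N L r"
    using regular_on_extension[OF N K r Cons.prems(3) reg] .
  ultimately show ?case by simp
qed

text \<open>\<open>(K + R z) / K\<close> is \<open>R\<close> modulo the colon ideal of
  \<open>K\<close> and \<open>z\<close>.\<close>

lemma regular_on_cyc:
  assumes K: "subm scale R K" and r: "r \<in> R" and "regular_on (*) R {p \<in> R. p *s z \<in> K} r"
  shows "regular_on scale (cyc scale R K z) K r"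
  unfolding regular_on_def
proof (intro ballI impI)
  fix v assume "v \<in> cyc scale R K z" and rv: "r *s v \<in> K"
  then obtain k p where v: "v = k + p *s z" "k \<in> K" "p \<in> R" by (auto simp: cyc_def)
  have "r *s k + (r * p) *s z \<in> K" using rv v by (simp add: algebra_simps)
  then have "(r * p) *s z \<in> K" using K r v subm_cancel_left[OF K, of "r *s k"] by (simp add: subm_scale)
  then have "p *s z \<in> K" using assms(3) v r by (auto simp: regular_on_def R_mult)
  then show "v \<in> K" using v K by (simp add: subm_add)
qed

text \<open>Dividing the cyclic module by \<open>r\<close> amounts to enlarging \<open>K\<close> by
  \<open>r R z\<close>: the generator is still \<open>z\<close>, and the colon ideal grows by
  \<open>r R\<close>.\<close>

lemma weakly_regular_cyc:
  assumes "subm scale R K" "set rs \<subseteq> R" "weakly_regular (*) R {p \<in> R. p *s z \<in> K} rs"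
  shows "weakly_regular scale (cyc scale R K z) K rs"
  using assms
proof (induction rs arbitrary: K)
  case Nil
  show ?case by simp
next
  case (Cons r rs)
  note K = Cons.prems(1)
  have r: "r \<in> R" using Cons.prems by simp
  let ?N = "cyc scale R K z"
  let ?K = "addm scale K r ?N"
  have K': "?K = {k + (r * p) *s z | k p. k \<in> K \<and> p \<in> R}"
  proof
    show "?K \<subseteq> {k + (r * p) *s z | k p. k \<in> K \<and> p \<in> R}"
    proof
      fix u assume "u \<in> ?K"
      then obtain k k' p where u: "u = k + r *s (k' + p *s z)" "k \<in> K" "k' \<in> K" "p \<in> R"
        by (auto simp: addm_def cyc_def)
      then have "u = (k + r *s k') + (r * p) *s z" "k + r *s k' \<in> K"
        using K r by (auto simp: algebra_simps subm_add subm_scale)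
      then show "u \<in> {k + (r * p) *s z | k p. k \<in> K \<and> p \<in> R}" using u by blast
    qed
    show "{k + (r * p) *s z | k p. k \<in> K \<and> p \<in> R} \<subseteq> ?K"
    proof clarify
      fix k p assume kp: "k \<in> K" "p \<in> R"
      then have "p *s z \<in> ?N" using subm_cyc[OF K] cyc_generator[OF K] by (blast intro: subm_scale)
      moreover have "k + (r * p) *s z = k + r *s (p *s z)" by simp
      ultimately show "k + (r * p) *s z \<in> ?K"
        unfolding addm_def using kp by blast
    qed
  qed
  have cyc': "cyc scale R ?K z = ?N"
  proof
    show "cyc scale R ?K z \<subseteq> ?N"
      by (intro cyc_subset addm_subset subm_cyc K cyc_superset r cyc_generator)
    show "?N \<subseteq> cyc scale R ?K z"
      by (intro cyc_mono addm_superset subm_cyc K)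
  qed
  have colon: "{p \<in> R. p *s z \<in> ?K} = addm (*) {p \<in> R. p *s z \<in> K} r R"
  proof
    show "{p \<in> R. p *s z \<in> ?K} \<subseteq> addm (*) {p \<in> R. p *s z \<in> K} r R"
    proof clarify
      fix p assume p: "p \<in> R" "p *s z \<in> ?K"
      then obtain k p' where "p *s z = k + (r * p') *s z" "k \<in> K" "p' \<in> R"
        unfolding K' by blast
      moreover from this have "(p - r * p') *s z = k" by (simp add: algebra_simps)
      moreover have "p = (p - r * p') + r * p'" by simp
      ultimately show "p \<in> addm (*) {p \<in> R. p *s z \<in> K} r R"
        unfolding addm_def using p r R_diff R_mult by blast
    qed
    show "addm (*) {p \<in> R. p *s z \<in> K} r R \<subseteq> {p \<in> R. p *s z \<in> ?K}"
    proof
      fix u assume "u \<in> addm (*) {p \<in> R. p *s z \<in> K} r R"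
      then obtain p p' where "u = p + r * p'" "p \<in> R" "p *s z \<in> K" "p' \<in> R"
        by (auto simp: addm_def)
      moreover from this have "u *s z = p *s z + (r * p') *s z" by (simp add: algebra_simps)
      ultimately show "u \<in> {p \<in> R. p *s z \<in> ?K}"
        unfolding K' using r R_add R_mult by blast
    qed
  qed
  have "weakly_regular scale (cyc scale R ?K z) ?K rs"
    using Cons.prems colon by (intro Cons.IH subm_addm K subm_cyc) simp_all
  moreover have "regular_on scale ?N K r"
    using Cons.prems by (intro regular_on_cyc K r) auto
  ultimately show ?case by (simp add: cyc')
qed

lemma filtered_regular_on:
  assumes "filtered scale R \<J> L N" "subm scale R L" "r \<in> R" "\<And>J. J \<in> \<J> \<Longrightarrow> regular_on (*) R J r"
  shows "regular_on scale N L r"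
  using assms(1)
proof induction
  case filtered_refl
  show ?case by (simp add: regular_on_def)
next
  case (filtered_step K z)
  have K: "subm scale R K" by (rule filtered_subm) fact+
  have "regular_on scale (cyc scale R K z) K r"
    using filtered_step assms by (intro regular_on_cyc K) auto
  then show ?case
    using regular_on_extension[OF subm_cyc[OF K] K assms(3)] filtered_step.IH
      filtered_subset[OF filtered_step.hyps(1)] by simp
qed

lemma filtered_weakly_regular:
  assumes "filtered scale R \<J> L N" "subm scale R L" "set rs \<subseteq> R"
    "\<And>J. J \<in> \<J> \<Longrightarrow> weakly_regular (*) R J rs"
  shows "weakly_regular scale N L rs"
  using assms(1)
proof induction
  case filtered_refl
  \<comment> \<open>The zero module, treated for every \<open>L'\<close> above \<open>L\<close>
    because the recursion enlarges the second submodule while the first stays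
    \<open>L\<close>.\<close>
  have "weakly_regular scale L L' rs" if "L \<subseteq> L'" "subm scale R L" for L L' rs
    using that
  proof (induction rs arbitrary: L')
    case (Cons r rs)
    then have "L \<subseteq> addm scale L' r L" using addm_superset[of L L' r] by simp
    with Cons show ?case by (auto simp: regular_on_def)
  qed simp
  then show ?case using assms(2) by blast
next
  case (filtered_step K z)
  have K: "subm scale R K" by (rule filtered_subm) fact+
  have "weakly_regular scale (cyc scale R K z) K rs"
    using filtered_step assms by (intro weakly_regular_cyc K) auto
  then show ?case
    using weakly_regular_extension[OF subm_cyc[OF K] K assms(2) _ cyc_superset assms(3)]
      filtered_step.IH filtered_subset[OF filtered_step.hyps(1)] by simp
qed

section \<open>Transport of filtrations along linear maps and modulo a regular element\<close>

text \<open>By \<open>ker\<close>, \<open>f\<close> induces an injection of \<open>N / L\<close>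
  into the ambient module modulo \<open>L'\<close>. The filtration is carried over to the image
  generator by generator, with the same annihilators.\<close>

lemma filtered_image:
  assumes "filtered scale R \<J> L N" "subm scale R L" "subm scale R L'"
    and add: "\<And>u v. f (u + v) = f u + f v" and scl: "\<And>p v. f (p *s v) = p *s f v"
    and ker: "\<And>v. v \<in> N \<Longrightarrow> f v \<in> L' \<longleftrightarrow> v \<in> L"
  shows "filtered scale R \<J> L' {f v + l | v l. v \<in> N \<and> l \<in> L'}"
  using assms(1,6)
proof induction
  case filtered_refl
  then have "{f v + l | v l. v \<in> L \<and> l \<in> L'} = L'"
  proof -
    have "f 0 = 0" using add[of 0 0] by simp
    then have "l \<in> {f v + l | v l. v \<in> L \<and> l \<in> L'}" if "l \<in> L'" for l
      using that subm_zero[OF assms(2)] by force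
    moreover have "f v + l \<in> L'" if "v \<in> L" "l \<in> L'" for v l
      using that filtered_refl assms(3) by (simp add: subm_add)
    ultimately show ?thesis by blast
  qed
  then show ?case by (simp add: filtered.filtered_refl)
next
  case (filtered_step K z)
  have K: "subm scale R K" by (rule filtered_subm) fact+
  have LK: "L \<subseteq> K" using filtered_step filtered_subset by blast
  let ?K = "{f v + l | v l. v \<in> K \<and> l \<in> L'}"
  have N: "subm scale R (cyc scale R K z)" by (rule subm_cyc[OF K])
  have zN: "z \<in> cyc scale R K z" by (rule cyc_generator[OF K])
  have KN: "K \<subseteq> cyc scale R K z" by (rule cyc_superset)
  have fd: "f (u - v) = f u - f v" for u v using add[of "u - v" v] by simp
  \<comment> \<open>If \<open>p *s f z = f v + l\<close>, then \<open>f\<close> sends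
    \<open>p *s z - v\<close> into \<open>L'\<close>, so this element lies in \<open>L\<close> and
    hence in \<open>K\<close>.\<close>
  have colon: "{p \<in> R. p *s f z \<in> ?K} = {p \<in> R. p *s z \<in> K}"
  proof (intro Collect_cong conj_cong refl iffI)
    fix p assume p: "p \<in> R"
    {
      assume "p *s f z \<in> ?K"
      then obtain v l where vl: "p *s f z = f v + l" "v \<in> K" "l \<in> L'" by blast
      then have "f (p *s z - v) \<in> L'" by (simp add: fd scl)
      then have "p *s z - v \<in> L" using filtered_step.prems vl p N zN KN
        by (meson subm_diff subm_scale subsetD)
      then have "p *s z - v \<in> K" using LK by blast
      then show "p *s z \<in> K" using K vl subm_add[of K "p *s z - v" v] by simp
    next
      assume "p *s z \<in> K"
      then have "f (p *s z) + 0 \<in> ?K" using subm_zero[OF assms(3)] by blast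
      then show "p *s f z \<in> ?K" by (simp add: scl)
    }
  qed
  have filt: "filtered scale R \<J> L' ?K"
    using filtered_step.prems KN by (intro filtered_step.IH) blast
  have eq: "{f v + l | v l. v \<in> cyc scale R K z \<and> l \<in> L'} = cyc scale R ?K (f z)"
  proof
    show "{f v + l | v l. v \<in> cyc scale R K z \<and> l \<in> L'} \<subseteq> cyc scale R ?K (f z)"
    proof clarify
      fix v l assume "v \<in> cyc scale R K z" "l \<in> L'"
      then obtain k p where "f v + l = (f k + l) + p *s f z" "k \<in> K" "p \<in> R"
        by (auto simp: cyc_def add scl)
      then show "f v + l \<in> cyc scale R ?K (f z)" unfolding cyc_def using \<open>l \<in> L'\<close> by blast
    qed
    show "cyc scale R ?K (f z) \<subseteq> {f v + l | v l. v \<in> cyc scale R K z \<and> l \<in> L'}"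
    proof
      fix u assume "u \<in> cyc scale R ?K (f z)"
      then obtain k p l where "u = (f k + l) + p *s f z" "k \<in> K" "p \<in> R" "l \<in> L'"
        unfolding cyc_def by blast
      then have "u = f (k + p *s z) + l" "k \<in> K" "p \<in> R" "l \<in> L'"
        by (simp_all add: add scl algebra_simps)
      moreover from this have "k + p *s z \<in> cyc scale R K z" by (auto simp: cyc_def)
      ultimately show "u \<in> {f v + l | v l. v \<in> cyc scale R K z \<and> l \<in> L'}" by blast
    qed
  qed
  show ?case by (rule filtered_stepI[OF filt colon filtered_step.hyps(2) eq])
qed

text \<open>\<open>f\<close> induces an isomorphism from the quotient of the two preimages in
  \<open>N\<close> to \<open>N' / L'\<close>; generators are lifted by surjectivity.\<close>

lemma filtered_vimage:
  assumes "filtered scale R \<J> L' N'" "subm scale R L'" "subm scale R N"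
    and add: "\<And>u v. f (u + v) = f u + f v" and scl: "\<And>p v. f (p *s v) = p *s f v"
    and surj: "N' \<subseteq> f ` N"
  shows "filtered scale R \<J> {v \<in> N. f v \<in> L'} {v \<in> N. f v \<in> N'}"
  using assms(1,6)
proof induction
  case filtered_refl
  show ?case by (simp add: filtered.filtered_refl)
next
  case (filtered_step K z)
  have K: "subm scale R K" by (rule filtered_subm) fact+
  let ?K = "{v \<in> N. f v \<in> K}"
  obtain y where y: "y \<in> N" "z = f y" using filtered_step.prems cyc_generator[OF K, of z] by blast
  have fd: "f (u - v) = f u - f v" for u v using add[of "u - v" v] by simp
  have colon: "{p \<in> R. p *s y \<in> ?K} = {p \<in> R. p *s z \<in> K}"
    using y assms(3) by (auto simp: scl subm_scale)
  have filt: "filtered scale R \<J> {v \<in> N. f v \<in> L'} ?K"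
    using filtered_step.prems cyc_superset[of K z] by (intro filtered_step.IH) blast
  have eq: "{v \<in> N. f v \<in> cyc scale R K z} = cyc scale R ?K y"
  proof
    show "{v \<in> N. f v \<in> cyc scale R K z} \<subseteq> cyc scale R ?K y"
    proof clarify
      fix v assume v: "v \<in> N" "f v \<in> cyc scale R K z"
      then obtain k p where k: "f v = k + p *s z" "k \<in> K" "p \<in> R" by (auto simp: cyc_def)
      then have "v - p *s y \<in> ?K"
        using v y assms(3) by (auto simp: fd scl subm_diff subm_scale)
      moreover have "v = (v - p *s y) + p *s y" by simp
      ultimately show "v \<in> cyc scale R ?K y" unfolding cyc_def using k by blast
    qed
    show "cyc scale R ?K y \<subseteq> {v \<in> N. f v \<in> cyc scale R K z}"
    proof
      fix v assume "v \<in> cyc scale R ?K y"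
      then obtain k p where v: "v = k + p *s y" "k \<in> N" "f k \<in> K" "p \<in> R"
        unfolding cyc_def by blast
      then have "f v = f k + p *s z" "v \<in> N"
        using y assms(3) by (simp_all add: add scl subm_add subm_scale)
      then show "v \<in> {v \<in> N. f v \<in> cyc scale R K z}" unfolding cyc_def using v by blast
    qed
  qed
  show ?case by (rule filtered_stepI[OF filt colon filtered_step.hyps(2) eq])
qed

text \<open>\<open>N\<close> stays fixed while \<open>K\<close> climbs the filtration. As
  \<open>w\<close> is regular on \<open>N / K\<close> and on every cyclic quotient
  \<open>R / J\<close>, reduction modulo \<open>w\<close> keeps the filtration exact and replaces
  \<open>R / J\<close> by \<open>R / (J + w R)\<close>.\<close>

lemma filtered_addm:
  assumes "filtered scale R \<J> L K" "subm scale R L" "subm scale R N" "K \<subseteq> N" "w \<in> R"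
    and "regular_on scale N K w"
    and \<J>: "\<And>J. J \<in> \<J> \<Longrightarrow> regular_on (*) R J w" "\<And>J. J \<in> \<J> \<Longrightarrow> addm (*) J w R \<in> \<J>'"
  shows "filtered scale R \<J>' (addm scale L w N) (addm scale K w N)"
  using assms(1,4,6)
proof induction
  case filtered_refl
  show ?case by (rule filtered.filtered_refl)
next
  case (filtered_step K z)
  have K: "subm scale R K" by (rule filtered_subm) fact+
  note N = assms(3) and w = assms(5)
  let ?K1 = "cyc scale R K z"
  have K1: "subm scale R ?K1" by (rule subm_cyc[OF K])
  have zN: "z \<in> N" using cyc_generator[OF K] filtered_step.prems by blast
  have KN: "K \<subseteq> N" using cyc_superset filtered_step.prems by blast
  let ?J = "{p \<in> R. p *s z \<in> K}"
  \<comment> \<open>Regularity descends from \<open>N / ?K1\<close> to \<open>N / K\<close>, since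
    \<open>?K1 / K\<close> is the cyclic quotient \<open>R / ?J\<close>.\<close>
  have "regular_on scale N K w"
    using filtered_step.hyps filtered_step.prems(2) \<J>(1)
    by (intro regular_on_extension[OF N K1 w cyc_superset regular_on_cyc[OF K w]]) auto
  then have 1: "filtered scale R \<J>' (addm scale L w N) (addm scale K w N)"
    using KN by (intro filtered_step.IH)
  have 2: "addm scale ?K1 w N = cyc scale R (addm scale K w N) z"
  proof
    show "addm scale ?K1 w N \<subseteq> cyc scale R (addm scale K w N) z"
    proof
      fix u assume "u \<in> addm scale ?K1 w N"
      then obtain k p v where "u = (k + p *s z) + w *s v" "k \<in> K" "p \<in> R" "v \<in> N"
        unfolding cyc_def addm_def by blast
      then have "u = (k + w *s v) + p *s z" "k \<in> K" "p \<in> R" "v \<in> N" by (simp_all add: algebra_simps)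
      then show "u \<in> cyc scale R (addm scale K w N) z" unfolding cyc_def addm_def by blast
    qed
    show "cyc scale R (addm scale K w N) z \<subseteq> addm scale ?K1 w N"
    proof
      fix u assume "u \<in> cyc scale R (addm scale K w N) z"
      then obtain k p v where "u = (k + w *s v) + p *s z" "k \<in> K" "p \<in> R" "v \<in> N"
        unfolding cyc_def addm_def by blast
      then have "u = (k + p *s z) + w *s v" "k \<in> K" "p \<in> R" "v \<in> N" by (simp_all add: algebra_simps)
      then show "u \<in> addm scale ?K1 w N" unfolding cyc_def addm_def by blast
    qed
  qed
  have 3: "{p \<in> R. p *s z \<in> addm scale K w N} = addm (*) ?J w R"
  proof
    show "{p \<in> R. p *s z \<in> addm scale K w N} \<subseteq> addm (*) ?J w R"
    proof clarify
      fix p assume p: "p \<in> R" "p *s z \<in> addm scale K w N"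
      then obtain k u where ku: "p *s z = k + w *s u" "k \<in> K" "u \<in> N" by (auto simp: addm_def)
      then have "w *s u = - k + p *s z" by simp
      \<comment> \<open>Regularity of \<open>w\<close> on \<open>N / ?K1\<close> puts
        \<open>u\<close> itself into \<open>?K1\<close>, which yields the multiple of
        \<open>w\<close> to subtract from \<open>p\<close>.\<close>
      then have "w *s u \<in> ?K1" unfolding cyc_def using subm_uminus[OF K] ku p by blast
      then have "u \<in> ?K1" using filtered_step.prems ku by (auto simp: regular_on_def)
      then obtain k' r where r: "u = k' + r *s z" "k' \<in> K" "r \<in> R" by (auto simp: cyc_def)
      then have "(p - w * r) *s z = k + w *s k'" using ku by (simp add: algebra_simps)
      then have "p - w * r \<in> ?J" using K w ku p r by (simp add: subm_add subm_scale R_diff R_mult)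
      moreover have "p = (p - w * r) + w * r" by simp
      ultimately show "p \<in> addm (*) ?J w R" unfolding addm_def using r by blast
    qed
    show "addm (*) ?J w R \<subseteq> {p \<in> R. p *s z \<in> addm scale K w N}"
    proof
      fix u assume "u \<in> addm (*) ?J w R"
      then obtain p r where "u = p + w * r" "p \<in> ?J" "r \<in> R" by (auto simp: addm_def)
      moreover from this have "u *s z = p *s z + w *s (r *s z)" "r *s z \<in> N"
        using N zN by (auto simp: algebra_simps subm_scale)
      ultimately show "u \<in> {p \<in> R. p *s z \<in> addm scale K w N}"
        unfolding addm_def using w R_add R_mult by blast
    qed
  qed
  show ?case by (rule filtered_stepI[OF 1 3 \<J>(2)[OF filtered_step.hyps(2)] 2])
qed

text \<open>The case \<open>K = N\<close>, where \<open>N / K\<close> is zero and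
  \<open>N + w N = N\<close>; the filtered module is \<open>N / L\<close> modulo
  \<open>w\<close>.\<close>

lemma filtered_addm_self:
  assumes "filtered scale R \<J> L N" "subm scale R L" "w \<in> R"
    and \<J>: "\<And>J. J \<in> \<J> \<Longrightarrow> regular_on (*) R J w" "\<And>J. J \<in> \<J> \<Longrightarrow> addm (*) J w R \<in> \<J>'"
  shows "filtered scale R \<J>' (addm scale L w N) N"
proof -
  have N: "subm scale R N" by (rule filtered_subm[OF assms(1,2)])
  have "addm scale N w N = N"
    using addm_superset[OF N] addm_subset[OF N _ assms(3), of N] by blast
  then show ?thesis
    using filtered_addm[OF assms(1,2) N _ assms(3), of \<J>'] \<J> N assms(3)
    by (auto simp: regular_on_def)
qed

end

section \<open>Ideals generated by variables\<close>

definition polys :: "nat \<Rightarrow> 'k::field pl set" where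
  "polys n = {p. inPn n p}"

definition var_ideal :: "nat \<Rightarrow> nat set \<Rightarrow> 'k::field pl set" where
  "var_ideal n S = {p \<in> polys n. \<forall>m\<in>Poly_Mapping.keys p. Poly_Mapping.keys m \<inter> S \<noteq> {}}"

lemma keys_add_nat: "Poly_Mapping.keys (a + b) = Poly_Mapping.keys a \<union> Poly_Mapping.keys (b :: 'a \<Rightarrow>\<^sub>0 nat)"
  by (auto simp: in_keys_iff lookup_add)

lemma polys_module: "subring_module ((*) :: 'k::field pl \<Rightarrow> 'k pl \<Rightarrow> 'k pl) (polys n)"
proof
  fix p r :: "'k pl"
  show "1 \<in> (polys n :: 'k pl set)" by (simp add: polys_def inPn_def)
  show "- p \<in> polys n" if "p \<in> polys n"
    using that by (simp add: polys_def inPn_def in_keys_iff)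
  assume pr: "p \<in> polys n" "r \<in> polys n"
  then show "p + r \<in> polys n"
    using Poly_Mapping.keys_add[of p r] by (auto simp: polys_def inPn_def)
  from pr show "p * r \<in> polys n"
    using Poly_Mapping.keys_mult[of p r] by (fastforce simp: polys_def inPn_def keys_add_nat)
qed (simp_all add: algebra_simps)

interpretation polys: subring_module "(*) :: 'k::field pl \<Rightarrow> 'k pl \<Rightarrow> 'k pl" "polys n" for n
  by (rule polys_module)

declare polys.scale_scale [simp del]

lemma subm_polys: "subm (*) (polys n) (polys n)"
  by (simp add: subm_def polys.R_zero polys.R_add polys.R_mult)

lemma pl_sum_monomials: "p = (\<Sum>m\<in>Poly_Mapping.keys p. Poly_Mapping.single m (Poly_Mapping.lookup p m))"
  by (rule poly_mapping_eqI)
    (simp add: lookup_sum lookup_single when_def in_keys_iff)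

lemma lookup_monomial_mult:
  "Poly_Mapping.lookup (Poly_Mapping.single m c * p) (m + k) = c * Poly_Mapping.lookup (p :: 'k::field pl) k"
proof -
  have "Poly_Mapping.single m c * p
      = (\<Sum>a\<in>Poly_Mapping.keys p. Poly_Mapping.single (m + a) (c * Poly_Mapping.lookup p a))"
    by (subst pl_sum_monomials[of p]) (simp add: sum_distrib_left mult_single)
  then show ?thesis
    by (simp add: lookup_sum lookup_single when_def in_keys_iff)
qed

lemma facet_monomial_singleton: "facet_monomial {v} = Poly_Mapping.single (Poly_Mapping.single v 1) 1"
  by (simp add: facet_monomial_def)

lemma facet_monomial_empty: "facet_monomial {} = 1"
  by (simp add: facet_monomial_def)

lemma facet_monomial_insert:
  "finite A \<Longrightarrow> v \<notin> A \<Longrightarrow> facet_monomial (insert v A) = facet_monomial {v} * facet_monomial A"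
  by (simp add: facet_monomial_def mult_single)

lemma facet_monomial_union:
  "finite A \<Longrightarrow> finite B \<Longrightarrow> A \<inter> B = {} \<Longrightarrow> facet_monomial (A \<union> B) = facet_monomial A * facet_monomial B"
  unfolding facet_monomial_def mult_single by (subst sum.union_disjoint) auto

lemma keys_sum_single: "finite A \<Longrightarrow> Poly_Mapping.keys (\<Sum>v\<in>A. Poly_Mapping.single v (Suc 0)) = A"
proof (induction A rule: finite_induct)
  case (insert v A)
  then show ?case by (subst sum.insert) (simp_all add: keys_add_nat)
qed simp

lemma keys_facet_monomial:
  "Poly_Mapping.keys (facet_monomial A :: 'k::field pl) = {\<Sum>v\<in>A. Poly_Mapping.single v (Suc 0)}"
  by (simp add: facet_monomial_def)

lemma facet_monomial_polys: "A \<subseteq> {..<n} \<Longrightarrow> facet_monomial A \<in> polys n"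
  using finite_subset[of A "{..<n}"]
  by (simp add: polys_def inPn_def keys_facet_monomial keys_sum_single)

lemma facet_monomial_var_ideal:
  "A \<subseteq> {..<n} \<Longrightarrow> A \<inter> S \<noteq> {} \<Longrightarrow> facet_monomial A \<in> var_ideal n S"
  using finite_subset[of A "{..<n}"] facet_monomial_polys[of A n]
  by (simp add: var_ideal_def keys_facet_monomial keys_sum_single)

lemma subm_var_ideal: "subm (*) (polys n) (var_ideal n S)"
  unfolding subm_def
proof (intro conjI ballI)
  show "0 \<in> var_ideal n S" by (simp add: var_ideal_def polys.R_zero)
  fix u assume u: "u \<in> var_ideal n S"
  show "u + v \<in> var_ideal n S" if "v \<in> var_ideal n S" for v
    using u that Poly_Mapping.keys_add[of u v] by (auto simp: var_ideal_def polys.R_add)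
  show "p * u \<in> var_ideal n S" if "p \<in> polys n" for p
    using u that Poly_Mapping.keys_mult[of p u]
    by (fastforce simp: var_ideal_def keys_add_nat intro: polys.R_mult)
qed

lemma var_ideal_empty: "var_ideal n {} = {0}"
  by (auto simp: var_ideal_def polys.R_zero)

lemma lookup_var_ideal: "p \<in> var_ideal n S \<Longrightarrow> Poly_Mapping.lookup p 0 = 0"
  by (force simp: var_ideal_def in_keys_iff)

text \<open>Multiplication by the variable adds only \<open>w\<close> to the support of a monomial,
  and \<open>w\<close> is not in \<open>S\<close>.\<close>

lemma regular_on_var_ideal:
  assumes "w \<notin> S"
  shows "regular_on (*) (polys n) (var_ideal n S) (facet_monomial {w})"
  unfolding regular_on_def
proof (intro ballI impI)
  fix p assume p: "p \<in> polys n" and xp: "facet_monomial {w} * p \<in> var_ideal n S"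
  have "Poly_Mapping.keys m \<inter> S \<noteq> {}" if "m \<in> Poly_Mapping.keys p" for m
  proof -
    have "Poly_Mapping.single w 1 + m \<in> Poly_Mapping.keys (facet_monomial {w} * p)"
      using that by (simp add: facet_monomial_singleton in_keys_iff lookup_monomial_mult)
    then have "Poly_Mapping.keys (Poly_Mapping.single w 1 + m) \<inter> S \<noteq> {}"
      using xp unfolding var_ideal_def by blast
    then show ?thesis using assms by (simp add: keys_add_nat)
  qed
  then show "p \<in> var_ideal n S" using p by (simp add: var_ideal_def)
qed

text \<open>A monomial of \<open>?I\<close> whose support misses \<open>S\<close> must contain
  \<open>w\<close>, so it is divisible by that variable; all other monomials of \<open>?I\<close>
  lie in the smaller ideal already.\<close>

lemma addm_var_ideal:
  assumes "w < n"
  shows "addm (*) (var_ideal n S :: 'k::field pl set) (facet_monomial {w}) (polys n)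
    = var_ideal n (insert w S)" (is "?J = ?I")
proof
  have "var_ideal n S \<subseteq> ?I" by (auto simp: var_ideal_def)
  moreover have "facet_monomial {w} * r \<in> ?I" if "r \<in> polys n" for r
    using polys.subm_scale[OF subm_var_ideal that facet_monomial_var_ideal[of "{w}" n "insert w S"]] assms
    by (simp add: mult.commute)
  ultimately show "?J \<subseteq> ?I"
    unfolding addm_def by (auto intro!: polys.subm_add[OF subm_var_ideal])
  show "?I \<subseteq> ?J"
  proof
    fix p assume p: "p \<in> ?I"
    have J: "subm (*) (polys n) ?J" by (intro polys.subm_addm subm_var_ideal subm_polys)
    have "Poly_Mapping.single m (Poly_Mapping.lookup p m) \<in> ?J" if m: "m \<in> Poly_Mapping.keys p" for m
    proof (cases "Poly_Mapping.keys m \<inter> S = {}")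
      case True
      then have w: "w \<in> Poly_Mapping.keys m" using p m by (auto simp: var_ideal_def)
      define m' where "m' = m - Poly_Mapping.single w 1"
      have mm': "m = Poly_Mapping.single w 1 + m'"
        using w by (intro poly_mapping_eqI)
          (auto simp: m'_def lookup_add lookup_minus lookup_single when_def in_keys_iff)
      have "Poly_Mapping.keys m \<subseteq> {..<n}" using p m by (auto simp: var_ideal_def polys_def inPn_def)
      then have "Poly_Mapping.single m' (Poly_Mapping.lookup p m) \<in> polys n"
        by (auto simp: mm' polys_def inPn_def keys_add_nat)
      then have "facet_monomial {w} * Poly_Mapping.single m' (Poly_Mapping.lookup p m) \<in> ?J"
        by (rule polys.scale_in_addm[OF subm_var_ideal])
      moreover have "facet_monomial {w} * Poly_Mapping.single m' (Poly_Mapping.lookup p m)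
          = Poly_Mapping.single m (Poly_Mapping.lookup p m)"
        unfolding facet_monomial_singleton mult_single mm'[symmetric] by simp
      ultimately show ?thesis by simp
    next
      case False
      then have "Poly_Mapping.single m (Poly_Mapping.lookup p m) \<in> var_ideal n S"
        using p m by (auto simp: var_ideal_def polys_def inPn_def)
      then show ?thesis using polys.addm_superset[OF subm_polys] by blast
    qed
    then show "p \<in> ?J"
      by (subst pl_sum_monomials) (intro polys.subm_sum[OF J])
  qed
qed

section \<open>The elementary symmetric polynomials as a universal regular sequence\<close>

definition mdeg :: "(nat \<Rightarrow>\<^sub>0 nat) \<Rightarrow> nat" where
  "mdeg m = (\<Sum>v\<in>Poly_Mapping.keys m. Poly_Mapping.lookup m v)"

definition homog :: "nat \<Rightarrow> 'k::field pl \<Rightarrow> bool" where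
  "homog d p \<longleftrightarrow> (\<forall>m\<in>Poly_Mapping.keys p. mdeg m = d)"

definition hcomp :: "nat \<Rightarrow> 'k::field pl \<Rightarrow> 'k pl" where
  "hcomp k p = (\<Sum>m\<in>{m\<in>Poly_Mapping.keys p. mdeg m = k}. Poly_Mapping.single m (Poly_Mapping.lookup p m))"

definition graded :: "'k::field pl set \<Rightarrow> bool" where
  "graded J \<longleftrightarrow> (\<forall>p\<in>J. \<forall>k. hcomp k p \<in> J)"

lemma mdeg_add: "mdeg (a + b) = mdeg a + mdeg b"
  unfolding mdeg_def by (rule setsum_keys_plus_distrib) auto

lemma lookup_hcomp:
  "Poly_Mapping.lookup (hcomp k p) m = (if mdeg m = k then Poly_Mapping.lookup p m else 0)"
  by (simp add: hcomp_def lookup_sum lookup_single when_def in_keys_iff)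

lemma keys_hcomp: "Poly_Mapping.keys (hcomp k p) = {m \<in> Poly_Mapping.keys p. mdeg m = k}"
  by (auto simp: in_keys_iff lookup_hcomp split: if_splits)

lemma hcomp_add: "hcomp k (p + r) = hcomp k p + hcomp k r"
  by (rule poly_mapping_eqI) (simp add: lookup_hcomp lookup_add)

lemma hcomp_zero: "hcomp k 0 = 0"
  by (rule poly_mapping_eqI) (simp add: lookup_hcomp)

lemma hcomp_sum: "hcomp k (sum f X) = (\<Sum>x\<in>X. hcomp k (f x))"
  by (induction X rule: infinite_finite_induct) (simp_all add: hcomp_zero hcomp_add)

lemma hcomp_single: "hcomp k (Poly_Mapping.single m c) = (if mdeg m = k then Poly_Mapping.single m c else 0)"
  by (rule poly_mapping_eqI) (simp add: lookup_hcomp lookup_single when_def)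

lemma sum_hcomp: "p = (\<Sum>k\<in>mdeg ` Poly_Mapping.keys p. hcomp k p)"
  by (rule poly_mapping_eqI) (auto simp: lookup_sum lookup_hcomp in_keys_iff)

text \<open>Multiplication by a homogeneous element of degree \<open>d\<close> shifts degrees by
  \<open>d\<close>; the case \<open>k < d\<close> is separate because \<open>k - d\<close>
  truncates.\<close>

lemma hcomp_mult:
  assumes "homog d r"
  shows "hcomp k (r * p) = (if d \<le> k then r * hcomp (k - d) p else 0)"
proof -
  let ?r = "\<lambda>a. Poly_Mapping.single a (Poly_Mapping.lookup r a)"
  let ?p = "\<lambda>b. Poly_Mapping.single b (Poly_Mapping.lookup p b)"
  have "r * p = (\<Sum>a\<in>Poly_Mapping.keys r. \<Sum>b\<in>Poly_Mapping.keys p. ?r a * ?p b)"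
    by (subst pl_sum_monomials[of r], subst pl_sum_monomials[of p]) (simp add: sum_product)
  then have "hcomp k (r * p) = (\<Sum>a\<in>Poly_Mapping.keys r. \<Sum>b\<in>Poly_Mapping.keys p. hcomp k (?r a * ?p b))"
    by (simp add: hcomp_sum)
  also have "\<dots> = (\<Sum>a\<in>Poly_Mapping.keys r. \<Sum>b\<in>Poly_Mapping.keys p.
      ?r a * (if d \<le> k then hcomp (k - d) (?p b) else 0))"
    using assms by (intro sum.cong refl) (auto simp: mult_single hcomp_single mdeg_add homog_def)
  also have "\<dots> = (\<Sum>a\<in>Poly_Mapping.keys r. ?r a) * (\<Sum>b\<in>Poly_Mapping.keys p.
      (if d \<le> k then hcomp (k - d) (?p b) else 0))"
    by (simp add: sum_product)
  also have "\<dots> = (if d \<le> k then r * hcomp (k - d) p else 0)"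
    by (simp flip: pl_sum_monomials hcomp_sum)
  finally show ?thesis .
qed

lemma hcomp_polys: "p \<in> polys n \<Longrightarrow> hcomp k p \<in> polys n"
  by (auto simp: polys_def inPn_def keys_hcomp)

lemma graded_var_ideal: "graded (var_ideal n S)"
  by (auto simp: graded_def var_ideal_def hcomp_polys keys_hcomp)

lemma graded_addm:
  assumes "graded J" "subm (*) (polys n) J" "homog d r"
  shows "graded (addm (*) J r (polys n))"
  unfolding graded_def
proof (intro ballI allI)
  fix p k assume "p \<in> addm (*) J r (polys n)"
  then obtain j u where ju: "p = j + r * u" "j \<in> J" "u \<in> polys n" by (auto simp: addm_def)
  define u' where "u' = (if d \<le> k then hcomp (k - d) u else 0)"
  have "hcomp k p = hcomp k j + r * u'"
    using ju assms by (simp add: hcomp_add hcomp_mult u'_def)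
  moreover have "hcomp k j \<in> J" "u' \<in> polys n"
    using ju assms by (auto simp: graded_def u'_def hcomp_polys polys.R_zero)
  ultimately show "hcomp k p \<in> addm (*) J r (polys n)" unfolding addm_def by blast
qed

section \<open>Permuting homogeneous regular sequences\<close>

text \<open>A homogeneous \<open>f\<close> with \<open>r * f \<in> J\<close> lies in
  \<open>J\<close> by induction on its degree: it vanishes modulo \<open>J\<close> and
  \<open>x\<close>, so \<open>f = j + x * g\<close> with \<open>g\<close> of smaller degree, and
  \<open>x\<close> can be cancelled from \<open>x * (r * g) \<in> J\<close>. A general
  \<open>f\<close> is split into its components.\<close>

lemma regular_on_graded:
  assumes J: "graded J" "subm (*) (polys n) J"
    and x: "homog 1 x" "x \<in> polys n" "regular_on (*) (polys n) J x"
    and r: "homog d r" "r \<in> polys n" "regular_on (*) (polys n) (addm (*) J x (polys n)) r"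
  shows "regular_on (*) (polys n) J r"
proof -
  have hom: "f \<in> J" if "f \<in> polys n" "hcomp k f = f" "r * f \<in> J" for k f
    using that
  proof (induction k arbitrary: f)
    case (0 f)
    then have "f \<in> addm (*) J x (polys n)"
      using r(3) polys.addm_superset[OF subm_polys, of J x] by (auto simp: regular_on_def)
    then obtain j g where "f = j + x * g" "j \<in> J" "g \<in> polys n" by (auto simp: addm_def)
    \<comment> \<open>The degree 0 component of \<open>x * g\<close> vanishes, as \<open>x\<close>
      has degree 1.\<close>
    then have "hcomp 0 f = hcomp 0 j" using x(1) by (simp add: hcomp_add hcomp_mult)
    also have "\<dots> \<in> J" using J(1) \<open>j \<in> J\<close> by (simp add: graded_def)
    finally show ?case using 0(2) by simp
  next
    case (Suc k f)
    from Suc.prems have "f \<in> addm (*) J x (polys n)"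
      using r(3) polys.addm_superset[OF subm_polys, of J x] by (auto simp: regular_on_def)
    then obtain j g where jg: "f = j + x * g" "j \<in> J" "g \<in> polys n" by (auto simp: addm_def)
    \<comment> \<open>Passing to the components of degree \<open>Suc k\<close> and \<open>k\<close>
      makes the decomposition of \<open>f\<close> homogeneous.\<close>
    define j' g' where "j' = hcomp (Suc k) j" and "g' = hcomp k g"
    have f: "f = j' + x * g'"
    proof -
      have "f = hcomp (Suc k) f" using Suc.prems(2) by simp
      also have "\<dots> = j' + x * g'"
        unfolding jg(1) using x(1) by (simp add: hcomp_add hcomp_mult j'_def g'_def)
      finally show ?thesis .
    qed
    have j': "j' \<in> J" using J jg by (simp add: graded_def j'_def)
    have g': "g' \<in> polys n" using jg by (simp add: g'_def hcomp_polys)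
    have "hcomp k g' = g'"
      unfolding g'_def by (rule poly_mapping_eqI) (simp add: lookup_hcomp)
    have "r * j' + x * (r * g') \<in> J"
      using Suc.prems(3) unfolding f by (simp add: algebra_simps)
    then have "x * (r * g') \<in> J"
      by (rule polys.subm_cancel_left[OF J(2) _ polys.subm_scale[OF J(2) r(2) j']])
    then have "r * g' \<in> J" using x(3) polys.R_mult[OF r(2) g'] by (simp add: regular_on_def)
    then have "g' \<in> J" by (rule Suc.IH[OF g' \<open>hcomp k g' = g'\<close>])
    then show ?case unfolding f by (intro polys.subm_add[OF J(2)] polys.subm_scale[OF J(2) x(2)] j')
  qed
  show ?thesis
    unfolding regular_on_def
  proof (intro ballI impI)
    fix f assume f: "f \<in> polys n" "r * f \<in> J"
    have "hcomp k f \<in> J" for k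
    proof (rule hom)
      show "hcomp k f \<in> polys n" using f by (simp add: hcomp_polys)
      show "hcomp k (hcomp k f) = hcomp k f"
        by (rule poly_mapping_eqI) (simp add: lookup_hcomp)
      have "hcomp (k + d) (r * f) \<in> J" using f J by (simp add: graded_def)
      then show "r * hcomp k f \<in> J" using r by (simp add: hcomp_mult)
    qed
    then show "f \<in> J"
      by (subst sum_hcomp) (intro polys.subm_sum[OF J(2)])
  qed
qed

text \<open>Moves \<open>x\<close> from the front of the sequence \<open>x # rs\<close> to its end.
  Each exchange with the next \<open>r\<close> requires regularity of \<open>r\<close> modulo
  \<open>J\<close>, which homogeneity provides, and of \<open>x\<close> modulo \<open>J\<close> and
  \<open>r\<close>.\<close>

lemma weakly_regular_permute:
  assumes "graded J" "subm (*) (polys n) J"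
    and x: "homog 1 x" "x \<in> polys n" "regular_on (*) (polys n) J x"
    and "\<And>r. r \<in> set rs \<Longrightarrow> r \<in> polys n \<and> (\<exists>d. homog d r)"
    and "weakly_regular (*) (polys n) (addm (*) J x (polys n)) rs"
  shows "weakly_regular (*) (polys n) J rs \<and> regular_on (*) (polys n) (addms (*) (polys n) J rs) x"
  using assms(1,2,5-)
proof (induction rs arbitrary: J)
  case Nil
  then show ?case by simp
next
  case (Cons r rs)
  note J = Cons.prems(1,2)
  obtain d where r: "r \<in> polys n" "homog d r" using Cons.prems(4) by auto
  have rJx: "regular_on (*) (polys n) (addm (*) J x (polys n)) r" using Cons.prems(5) by simp
  have rJ: "regular_on (*) (polys n) J r"
    using regular_on_graded[OF J x(1,2) Cons.prems(3) r(2,1) rJx] .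
  let ?J = "addm (*) J r (polys n)"
  \<comment> \<open>The exchange argument: \<open>x * u = j + r * v\<close> forces
    \<open>v = j' + x * v'\<close>, and then \<open>x\<close> can be cancelled from
    \<open>x * (u - r * v') \<in> J\<close>.\<close>
  have "regular_on (*) (polys n) ?J x"
    unfolding regular_on_def
  proof (intro ballI impI)
    fix u assume u: "u \<in> polys n" "x * u \<in> ?J"
    then obtain j v where jv: "x * u = j + r * v" "j \<in> J" "v \<in> polys n" by (auto simp: addm_def)
    have "r * v = (- j) + x * u" using jv by simp
    then have "r * v \<in> addm (*) J x (polys n)"
      unfolding addm_def using polys.subm_uminus[OF J(2)] jv u by blast
    then have "v \<in> addm (*) J x (polys n)" using rJx jv by (auto simp: regular_on_def)
    then obtain j' v' where v': "v = j' + x * v'" "j' \<in> J" "v' \<in> polys n" by (auto simp: addm_def)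
    have "x * (u - r * v') = j + r * j'" using jv v' by (simp add: algebra_simps)
    also have "\<dots> \<in> J" using J(2) jv v' r by (simp add: polys.subm_add polys.subm_scale)
    finally have "u - r * v' \<in> J"
      using Cons.prems(3) polys.R_diff[OF u(1) polys.R_mult[OF r(1) v'(3)]]
      by (simp add: regular_on_def)
    moreover have "u = (u - r * v') + r * v'" by simp
    ultimately show "u \<in> ?J" unfolding addm_def using v' by blast
  qed
  moreover have "weakly_regular (*) (polys n) (addm (*) ?J x (polys n)) rs"
    using Cons.prems(5) polys.addm_commute[of J r "polys n" x] by simp
  ultimately have "weakly_regular (*) (polys n) ?J rs \<and> regular_on (*) (polys n) (addms (*) (polys n) ?J rs) x"
    using Cons.prems(4) by (intro Cons.IH graded_addm[OF J r(2)] polys.subm_addm J subm_polys) auto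
  then show ?case using rJ by simp
qed

lemma weakly_regular_snoc:
  "weakly_regular s N L (rs @ [r]) \<longleftrightarrow> weakly_regular s N L rs \<and> regular_on s N (addms s N L rs) r"
  by (induction rs arbitrary: L) auto

lemma subm_addms: "subm (*) (polys n) J \<Longrightarrow> subm (*) (polys n) (addms (*) (polys n) J rs)"
  by (induction rs arbitrary: J) (auto intro: polys.subm_addm subm_polys)

lemma addms_superset: "J \<subseteq> addms (*) (polys n) J rs"
proof (induction rs arbitrary: J)
  case (Cons r rs)
  then show ?case using polys.addm_superset[OF subm_polys, of J r n] by auto
qed simp

section \<open>Regularity of the elementary symmetric polynomials\<close>

definition esym :: "nat \<Rightarrow> nat \<Rightarrow> 'k::field pl" where
  "esym n j = (\<Sum>T | T \<subseteq> {..<n} \<and> card T = j. facet_monomial T)"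

lemma esym_polys: "esym n j \<in> polys n"
  unfolding esym_def by (intro polys.subm_sum[OF subm_polys] facet_monomial_polys) simp

lemma mdeg_sum_single: "finite T \<Longrightarrow> mdeg (\<Sum>v\<in>T. Poly_Mapping.single v (Suc 0)) = card T"
  by (induction T rule: finite_induct) (simp_all add: mdeg_add, simp_all add: mdeg_def)

lemma homog_facet_monomial: "finite T \<Longrightarrow> homog (card T) (facet_monomial T)"
  by (simp add: homog_def keys_facet_monomial mdeg_sum_single)

lemma homog_esym: "homog j (esym n j)"
  unfolding homog_def
proof
  fix m assume "m \<in> Poly_Mapping.keys (esym n j :: 'a pl)"
  then have "(\<Sum>T | T \<subseteq> {..<n} \<and> card T = j. Poly_Mapping.lookup (facet_monomial T :: 'a pl) m) \<noteq> 0"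
    by (simp add: esym_def in_keys_iff lookup_sum)
  then obtain T where "T \<subseteq> {..<n}" "card T = j" "m \<in> Poly_Mapping.keys (facet_monomial T :: 'a pl)"
    by (auto simp: in_keys_iff elim: sum.not_neutral_contains_not_neutral)
  then show "mdeg m = j" using homog_facet_monomial[of T] finite_subset[of T "{..<n}"]
    unfolding homog_def by blast
qed

lemma regular_on_mult:
  assumes "regular_on (*) (polys n) K r" "regular_on (*) (polys n) K r'" "r' \<in> polys n"
  shows "regular_on (*) (polys n) K (r * r')"
  unfolding regular_on_def
proof (intro ballI impI)
  fix p assume p: "p \<in> polys n" "r * r' * p \<in> K"
  then have "r * (r' * p) \<in> K" by (simp add: mult.assoc)
  then have "r' * p \<in> K" using assms(1) polys.R_mult[OF assms(3) p(1)] by (simp add: regular_on_def)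
  then show "p \<in> K" using assms(2) p(1) by (simp add: regular_on_def)
qed

lemma lookup_homog: "homog d p \<Longrightarrow> d > 0 \<Longrightarrow> Poly_Mapping.lookup p 0 = 0"
  by (force simp: homog_def in_keys_iff mdeg_def)

text \<open>Induction on the number of variables outside \<open>S\<close>. The sequence does not
  depend on \<open>S\<close>, so it serves all cyclic quotients of a filtration at once.\<close>

lemma weakly_regular_esym:
  assumes "S \<subseteq> {..<n}" "d + card S \<le> n"
  shows "weakly_regular (*) (polys n) (var_ideal n S) (map (esym n :: nat \<Rightarrow> 'k::field pl) [1..<Suc d])"
  using assms
proof (induction "n - card S" arbitrary: S d rule: less_induct)
  case less
  let ?V = "{..<n} - S" and ?J = "var_ideal n S :: 'k pl set"
  let ?e = "\<lambda>d. map (esym n :: nat \<Rightarrow> 'k::field pl) [1..<Suc d]"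
  have finS: "finite S" using less.prems(1) by (rule finite_subset) simp
  have cardV: "card ?V = n - card S" using less.prems finS by (simp add: card_Diff_subset)
  \<comment> \<open>Put \<open>v\<close> into \<open>S\<close>, apply the induction hypothesis to
    the larger ideal, and move the variable of \<open>v\<close> behind the sequence.\<close>
  have step: "weakly_regular (*) (polys n) ?J (?e d') \<and>
      regular_on (*) (polys n) (addms (*) (polys n) ?J (?e d')) (facet_monomial {v})"
    if v: "v \<in> ?V" and d': "d' + card S < n" for v d'
  proof (rule weakly_regular_permute)
    show "homog 1 (facet_monomial {v} :: 'k pl)" using homog_facet_monomial[of "{v}"] by simp
    have "weakly_regular (*) (polys n) (var_ideal n (insert v S)) (?e d')"
      using v d' less.prems finS by (intro less.hyps) auto
    then show "weakly_regular (*) (polys n) (addm (*) ?J (facet_monomial {v}) (polys n)) (?e d')"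
      using v by (subst addm_var_ideal) auto
    show "r \<in> polys n \<and> (\<exists>d. homog d r)" if "r \<in> set (?e d')" for r
      using that by (auto intro: esym_polys homog_esym)
  qed (use v in \<open>auto intro: graded_var_ideal subm_var_ideal facet_monomial_polys regular_on_var_ideal\<close>)
  show ?case
  proof (cases d)
    case 0
    then show ?thesis by simp
  next
    case (Suc d')
    then have "card ?V > 0" using cardV less.prems(2) by linarith
    then have "?V \<noteq> {}" by (metis card.empty less_irrefl)
    then obtain v where v: "v \<in> ?V" by blast
    show ?thesis
    proof (cases "d + card S < n")
      case True
      then show ?thesis using step[OF v] by blast
    next
      case False
      then have dV: "d = card ?V" using less.prems cardV by simp
      have d': "d' + card S < n" using less.prems Suc by simp
      let ?K = "addms (*) (polys n) ?J (?e d')"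
      have K: "subm (*) (polys n) ?K" by (intro subm_addms subm_var_ideal)
      \<comment> \<open>Each variable outside \<open>S\<close> is regular modulo the first
        \<open>d'\<close> polynomials, hence so is any product of them.\<close>
      have "regular_on (*) (polys n) ?K (facet_monomial W)" if "W \<subseteq> ?V" for W
      proof -
        have "finite W" using that finite_subset by blast
        then show ?thesis using that
        proof (induction W rule: finite_induct)
          case empty
          then show ?case by (simp add: facet_monomial_empty regular_on_def)
        next
          case (insert w W)
          have "regular_on (*) (polys n) ?K (facet_monomial {w})" using step[OF _ d'] insert by blast
          then show ?case
            unfolding facet_monomial_insert[OF insert.hyps]
            using insert by (intro regular_on_mult facet_monomial_polys) auto
        qed
      qed
      then have regV: "regular_on (*) (polys n) ?K (facet_monomial ?V)" by blast
      \<comment> \<open>A set of \<open>d = card ?V\<close> vertices other than \<open>?V\<close>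
        meets \<open>S\<close>, so \<open>esym n d\<close> is congruent to the product of the
        variables outside \<open>S\<close>.\<close>
      have "esym n d - facet_monomial ?V = (\<Sum>T\<in>{T. T \<subseteq> {..<n} \<and> card T = d} - {?V}. facet_monomial T :: 'k pl)"
        unfolding esym_def by (subst sum.remove[of _ ?V]) (auto simp: dV)
      also have "\<dots> \<in> ?J"
      proof (intro polys.subm_sum[OF subm_var_ideal] facet_monomial_var_ideal)
        fix T assume T: "T \<in> {T. T \<subseteq> {..<n} \<and> card T = d} - {?V}"
        then show "T \<subseteq> {..<n}" by blast
        show "T \<inter> S \<noteq> {}"
        proof
          assume "T \<inter> S = {}"
          then have "T \<subseteq> ?V" using T by blast
          then have "T = ?V" using T dV by (intro card_subset_eq) auto
          then show False using T by blast
        qed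
      qed
      finally have diff: "esym n d - facet_monomial ?V \<in> ?K" using addms_superset by blast
      have "regular_on (*) (polys n) ?K (esym n d)"
        unfolding regular_on_def
      proof (intro ballI impI)
        fix p assume p: "p \<in> polys n" "esym n d * p \<in> ?K"
        have "p * (esym n d - facet_monomial ?V) \<in> ?K" by (rule polys.subm_scale[OF K p(1) diff])
        then have "esym n d * p - p * (esym n d - facet_monomial ?V) \<in> ?K"
          by (rule polys.subm_diff[OF K p(2)])
        then have "facet_monomial ?V * p \<in> ?K" by (simp add: algebra_simps)
        then show "p \<in> ?K" using regV p by (auto simp: regular_on_def)
      qed
      then have "weakly_regular (*) (polys n) ?J (?e d' @ [esym n d])"
        using step[OF v d'] by (simp add: weakly_regular_snoc)
      then show ?thesis using Suc by simp
    qed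
  qed
qed

section \<open>Koszul complexes\<close>

definition fscale :: "'k::field pl \<Rightarrow> (nat set \<Rightarrow> 'k pl) \<Rightarrow> (nat set \<Rightarrow> 'k pl)" where
  "fscale p v = (\<lambda>T. p * v T)"

interpretation fm: subring_module "fscale :: 'k::field pl \<Rightarrow> _" "polys n" for n
proof
  show "1 \<in> (polys n :: 'k pl set)" by (rule polys.R_one)
  show "\<And>p r. p \<in> (polys n :: 'k pl set) \<Longrightarrow> r \<in> polys n \<Longrightarrow> p + r \<in> polys n" by (rule polys.R_add)
  show "\<And>p r. p \<in> (polys n :: 'k pl set) \<Longrightarrow> r \<in> polys n \<Longrightarrow> p * r \<in> polys n" by (rule polys.R_mult)
  show "\<And>p. p \<in> (polys n :: 'k pl set) \<Longrightarrow> - p \<in> polys n" by (rule polys.R_uminus)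
qed (simp_all add: fscale_def fun_eq_iff algebra_simps)

text \<open>Degrees are integers so that \<open>i - 1\<close> makes sense for all \<open>i\<close>;
  chains of negative degree are zero. The index set is arbitrary because single generators are
  removed and added.\<close>

definition kchains :: "nat \<Rightarrow> nat set \<Rightarrow> int \<Rightarrow> (nat set \<Rightarrow> 'k::field pl) set" where
  "kchains n I i = {v. \<forall>T. v T \<in> polys n \<and> (v T \<noteq> 0 \<longrightarrow> T \<subseteq> I \<and> int (card T) = i)}"

text \<open>On chains over \<open>I\<close> the differential \<open>koszul_d M q\<close> involves
  only generators \<open>M l\<close> with \<open>l \<in> I\<close>, so for \<open>I\<close> inside
  \<open>{..<q}\<close> this belongs to the Koszul complex of that subfamily.\<close>

definition kcycles :: "nat \<Rightarrow> nat \<Rightarrow> (nat \<Rightarrow> 'k::field pl) \<Rightarrow> nat set \<Rightarrow> int \<Rightarrow> (nat set \<Rightarrow> 'k pl) set" where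
  "kcycles n q M I i = {v \<in> kchains n I i. koszul_d M q v = 0}"

definition kbounds :: "nat \<Rightarrow> nat \<Rightarrow> (nat \<Rightarrow> 'k::field pl) \<Rightarrow> nat set \<Rightarrow> int \<Rightarrow> (nat set \<Rightarrow> 'k pl) set" where
  "kbounds n q M I i = koszul_d M q ` kchains n I (i + 1)"

text \<open>\<open>wedge j u\<close> is the exterior product of \<open>e\<^sub>j\<close> and \<open>u\<close>.\<close>

definition wedge :: "nat \<Rightarrow> (nat set \<Rightarrow> 'k::field pl) \<Rightarrow> (nat set \<Rightarrow> 'k pl)" where
  "wedge j u = (\<lambda>T. if j \<in> T then (-1) ^ card {l\<in>T. l < j} * u (T - {j}) else 0)"

definition avoids :: "nat \<Rightarrow> (nat set \<Rightarrow> 'k::field pl) \<Rightarrow> bool" where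
  "avoids j u \<longleftrightarrow> (\<forall>T. j \<in> T \<longrightarrow> u T = 0)"

text \<open>\<open>part0 j v\<close> and \<open>part1 j v\<close> are the \<open>u0\<close> and
  \<open>u1\<close> free of \<open>j\<close> with \<open>v = u0 + wedge j u1\<close>; the sign in
  \<open>part1\<close> cancels the one in \<open>wedge\<close>.\<close>

definition part0 :: "nat \<Rightarrow> (nat set \<Rightarrow> 'k::field pl) \<Rightarrow> (nat set \<Rightarrow> 'k pl)" where
  "part0 j v = (\<lambda>T. if j \<in> T then 0 else v T)"

definition part1 :: "nat \<Rightarrow> (nat set \<Rightarrow> 'k::field pl) \<Rightarrow> (nat set \<Rightarrow> 'k pl)" where
  "part1 j v = (\<lambda>T. if j \<in> T then 0 else (-1) ^ card {l\<in>T. l < j} * v (insert j T))"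

lemma koszul_d_add: "koszul_d M q (u + v) = koszul_d M q u + koszul_d M q v"
  by (simp add: koszul_d_def fun_eq_iff algebra_simps sum.distrib)

lemma koszul_d_fscale: "koszul_d M q (fscale p v) = fscale p (koszul_d M q v)"
  by (simp add: koszul_d_def fscale_def fun_eq_iff sum_distrib_left algebra_simps)

lemma koszul_d_zero: "koszul_d M q 0 = 0"
  using koszul_d_add[of M q 0 0] by simp

lemma koszul_d_uminus: "koszul_d M q (- v) = - koszul_d M q v"
  using koszul_d_add[of M q v "- v"] by (simp add: koszul_d_zero eq_neg_iff_add_eq_0 add.commute)

lemma koszul_d_diff: "koszul_d M q (u - v) = koszul_d M q u - koszul_d M q v"
  using koszul_d_add[of M q u "- v"] by (simp add: koszul_d_uminus)

text \<open>Allows \<open>M j\<close> to be exchanged for another element as long as the chains do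
  not involve \<open>j\<close>.\<close>

lemma koszul_d_cong:
  assumes "v \<in> kchains n I i" "\<And>l. l \<in> I \<Longrightarrow> M l = M' l"
  shows "koszul_d M q v = koszul_d M' q v"
  unfolding koszul_d_def
proof (intro ext sum.cong refl)
  fix T j
  show "(-1) ^ card {l \<in> T. l < j} * M j * v (insert j T) = (-1) ^ card {l \<in> T. l < j} * M' j * v (insert j T)"
    using assms by (cases "v (insert j T) = 0") (auto simp: kchains_def)
qed

lemma sign_square: "(-1) ^ k * ((-1) ^ k * x) = (x :: 'a::comm_ring_1)"
  by (simp flip: mult.assoc power_add)

lemma part0_wedge: "avoids j u0 \<Longrightarrow> part0 j (u0 + wedge j u1) = u0"
  by (auto simp: part0_def wedge_def avoids_def fun_eq_iff)

lemma part1_wedge: "avoids j u0 \<Longrightarrow> avoids j u1 \<Longrightarrow> part1 j (u0 + wedge j u1) = u1"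
proof
  fix T assume *: "avoids j u0" "avoids j u1"
  have "{l \<in> insert j T. l < j} = {l \<in> T. l < j}" by auto
  then show "part1 j (u0 + wedge j u1) T = u1 T"
    using * by (auto simp: part1_def wedge_def avoids_def sign_square)
qed

lemma wedge_eq_iff:
  assumes "avoids j u0" "avoids j u1" "avoids j v0" "avoids j v1"
  shows "u0 + wedge j u1 = v0 + wedge j v1 \<longleftrightarrow> u0 = v0 \<and> u1 = v1"
  using part0_wedge part1_wedge assms by metis

lemma part_decomp: "v = part0 j v + wedge j (part1 j v)"
proof
  fix T
  show "v T = (part0 j v + wedge j (part1 j v)) T"
  proof (cases "j \<in> T")
    case True
    then have "insert j (T - {j}) = T" "{l \<in> T. l < j \<and> l \<noteq> j} = {l \<in> T. l < j}" by auto
    then show ?thesis using True by (simp add: part0_def part1_def wedge_def sign_square conj_ac)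
  qed (simp add: part0_def wedge_def)
qed

lemma part1_add: "part1 j (u + v) = part1 j u + part1 j v"
  by (simp add: part1_def fun_eq_iff algebra_simps)

lemma part1_fscale: "part1 j (fscale p v) = fscale p (part1 j v)"
  by (simp add: part1_def fscale_def fun_eq_iff)

lemma wedge_uminus: "wedge j (- u) = - wedge j u"
  by (simp add: wedge_def fun_eq_iff)

lemma wedge_add: "wedge j (u + v) = wedge j u + wedge j v"
  by (simp add: wedge_def fun_eq_iff algebra_simps)

lemma wedge_fscale: "wedge j (fscale p u) = fscale p (wedge j u)"
  by (simp add: wedge_def fscale_def fun_eq_iff)

lemma sign_polys: "p \<in> polys n \<Longrightarrow> (-1) ^ k * p \<in> polys n"
  by (cases "even k") (auto intro: polys.R_uminus)

lemma subm_kchains: "subm fscale (polys n) (kchains n I i :: (nat set \<Rightarrow> 'k::field pl) set)"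
  unfolding subm_def
proof (intro conjI ballI)
  show "0 \<in> kchains n I i" by (simp add: kchains_def polys.R_zero)
  fix u :: "nat set \<Rightarrow> 'k pl" assume u: "u \<in> kchains n I i"
  {
    fix v :: "nat set \<Rightarrow> 'k pl" assume v: "v \<in> kchains n I i"
    have "T \<subseteq> I \<and> int (card T) = i" if "u T + v T \<noteq> 0" for T
    proof -
      have "u T \<noteq> 0 \<or> v T \<noteq> 0" using that by auto
      then show ?thesis using u v by (auto simp: kchains_def)
    qed
    then show "u + v \<in> kchains n I i" using u v by (auto simp: kchains_def intro: polys.R_add)
  }
  fix p :: "'k pl" assume "p \<in> polys n"
  then show "fscale p u \<in> kchains n I i"
    using u by (auto simp: kchains_def fscale_def intro: polys.R_mult)
qed

lemma kchains_mono: "I \<subseteq> I' \<Longrightarrow> kchains n I i \<subseteq> kchains n I' i"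
  by (auto simp: kchains_def)

lemma kchains_avoids: "u \<in> kchains n I i \<Longrightarrow> j \<notin> I \<Longrightarrow> avoids j u"
  by (auto simp: kchains_def avoids_def)

lemma part0_kchains: "v \<in> kchains n (insert j I) i \<Longrightarrow> part0 j v \<in> kchains n I i"
  by (auto simp: kchains_def part0_def polys.R_zero)

lemma part1_kchains:
  assumes "finite I" "v \<in> kchains n (insert j I) i"
  shows "part1 j v \<in> kchains n I (i - 1)"
  unfolding kchains_def
proof (clarify, intro conjI impI)
  fix T
  show "part1 j v T \<in> polys n"
    using assms by (auto simp: part1_def kchains_def polys.R_zero intro: sign_polys)
  assume "part1 j v T \<noteq> 0"
  then have "j \<notin> T" "v (insert j T) \<noteq> 0" by (auto simp: part1_def split: if_splits)
  then have *: "j \<notin> T" "insert j T \<subseteq> insert j I" "int (card (insert j T)) = i"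
    using assms by (auto simp: kchains_def)
  then have "T \<subseteq> I" by auto
  moreover have "finite T" using \<open>T \<subseteq> I\<close> assms(1) by (rule finite_subset)
  ultimately show "T \<subseteq> I" "int (card T) = i - 1" using * by auto
qed

lemma wedge_kchains:
  assumes "finite I" "u \<in> kchains n I i" "j \<notin> I"
  shows "wedge j u \<in> kchains n (insert j I) (i + 1)"
  unfolding kchains_def
proof (clarify, intro conjI impI)
  fix T
  show "wedge j u T \<in> polys n"
    using assms by (auto simp: wedge_def kchains_def polys.R_zero intro: sign_polys)
  assume "wedge j u T \<noteq> 0"
  then have "j \<in> T" "u (T - {j}) \<noteq> 0" by (auto simp: wedge_def split: if_splits)
  then have *: "j \<in> T" "T - {j} \<subseteq> I" "int (card (T - {j})) = i"
    using assms by (auto simp: kchains_def)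
  moreover have "finite T" using finite_subset[OF *(2) assms(1)] by simp
  moreover have "card T > 0" using * \<open>finite T\<close> by (auto simp: card_gt_0_iff)
  ultimately show "T \<subseteq> insert j I" "int (card T) = i + 1" by auto
qed

lemma koszul_d_kchains:
  assumes "finite I" "v \<in> kchains n I i" "\<And>l. l < q \<Longrightarrow> M l \<in> polys n"
  shows "koszul_d M q v \<in> kchains n I (i - 1)"
  unfolding kchains_def
proof (clarify, intro conjI impI)
  fix T
  show "koszul_d M q v T \<in> polys n"
    unfolding koszul_d_def
  proof (rule polys.subm_sum[OF subm_polys])
    fix j assume "j \<in> {..<q} - T"
    then have "M j \<in> polys n" "v (insert j T) \<in> polys n" using assms by (auto simp: kchains_def)
    then show "(- 1) ^ card {l \<in> T. l < j} * M j * v (insert j T) \<in> polys n"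
      unfolding mult.assoc by (intro sign_polys polys.R_mult)
  qed
  assume "koszul_d M q v T \<noteq> 0"
  then obtain j where "j \<in> {..<q} - T" "v (insert j T) \<noteq> 0"
    unfolding koszul_d_def by (force elim: sum.not_neutral_contains_not_neutral)
  then have *: "j \<notin> T" "insert j T \<subseteq> I" "int (card (insert j T)) = i"
    using assms by (auto simp: kchains_def)
  then have "finite T" using assms(1) finite_subset by auto
  then show "T \<subseteq> I" "int (card T) = i - 1" using * by auto
qed

text \<open>The Leibniz rule for the exterior product with a basis element.\<close>

lemma koszul_d_wedge:
  assumes u: "avoids j u" and j: "j < q"
  shows "koszul_d M q (wedge j u) = fscale (M j) u - wedge j (koszul_d M q u)"
proof
  fix T
  let ?s = "\<lambda>l T. (-1) ^ card {k\<in>T. k < (l::nat)} :: 'a pl"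
  show "koszul_d M q (wedge j u) T = (fscale (M j) u - wedge j (koszul_d M q u)) T"
  proof (cases "j \<in> T")
    case False
    have eq: "{k \<in> insert j T. k < j} = {k \<in> T. k < j}" by auto
    have "koszul_d M q (wedge j u) T = (\<Sum>l\<in>{..<q} - T. if l = j then M j * u T else 0)"
      unfolding koszul_d_def wedge_def
    proof (intro sum.cong refl)
      fix l assume "l \<in> {..<q} - T"
      show "?s l T * M l * (if j \<in> insert l T then ?s j (insert l T) * u (insert l T - {j}) else 0)
          = (if l = j then M j * u T else 0)"
      proof (cases "l = j")
        case True
        then show ?thesis using False eq sign_square[of "card {k\<in>T. k < j}" "M j * u T"]
          by (simp add: ac_simps)
      qed (use False in auto)
    qed
    also have "\<dots> = M j * u T" using False j by simp
    finally show ?thesis using False by (simp add: fscale_def wedge_def)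
  next
    case True
    let ?T = "T - {j}"
    have insT: "insert j ?T = T" using True by auto
    have uT: "u T = 0" using u True by (simp add: avoids_def)
    have "koszul_d M q (wedge j u) T = (\<Sum>l\<in>{..<q} - T. - (?s j T * (?s l ?T * M l * u (insert l ?T))))"
      unfolding koszul_d_def wedge_def
    proof (intro sum.cong refl)
      fix l assume l: "l \<in> {..<q} - T"
      then have lj: "l \<noteq> j" using True by auto
      \<comment> \<open>Whichever of \<open>j\<close> and \<open>l\<close> is larger, exactly one of
        the two counts on the left exceeds its counterpart on the right by one: the sign of swapping
        two basis elements.\<close>
      have "?s l T * ?s j (insert l T) = - (?s j T * ?s l ?T)"
      proof (cases "j < l")
        case True
        then have "{k \<in> T. k < l} = insert j {k \<in> ?T. k < l}" using \<open>j \<in> T\<close> by auto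
        moreover have "{k \<in> insert l T. k < j} = {k \<in> T. k < j}" using True by auto
        moreover have "card (insert j {k \<in> ?T. k < l}) = Suc (card {k \<in> ?T. k < l})"
          by (subst card_insert_disjoint) auto
        ultimately show ?thesis by simp
      next
        case False
        then have "{k \<in> T. k < l} = {k \<in> ?T. k < l}" using lj by auto
        moreover have "{k \<in> insert l T. k < j} = insert l {k \<in> T. k < j}" using False lj by auto
        moreover have "card (insert l {k \<in> T. k < j}) = Suc (card {k \<in> T. k < j})"
          using l by (subst card_insert_disjoint) auto
        ultimately show ?thesis by simp
      qed
      moreover have "insert l T - {j} = insert l ?T" using lj by auto
      ultimately show "?s l T * M l * (if j \<in> insert l T then ?s j (insert l T) * u (insert l T - {j}) else 0)
          = - (?s j T * (?s l ?T * M l * u (insert l ?T)))"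
        using True by (simp add: algebra_simps)
    qed
    also have "\<dots> = - (?s j T * (\<Sum>l\<in>{..<q} - T. ?s l ?T * M l * u (insert l ?T)))"
      by (simp add: sum_distrib_left sum_negf)
    \<comment> \<open>The index \<open>j\<close> may be added to the range, since its term contains
      \<open>u T = 0\<close>.\<close>
    also have "(\<Sum>l\<in>{..<q} - T. ?s l ?T * M l * u (insert l ?T))
        = (\<Sum>l\<in>{..<q} - ?T. ?s l ?T * M l * u (insert l ?T))"
      using insT uT j by (intro sum.mono_neutral_left) auto
    finally show ?thesis using True uT by (simp add: fscale_def wedge_def koszul_d_def)
  qed
qed

text \<open>In components, the complex with generator \<open>j\<close> is the mapping cone of
  multiplication by \<open>M j\<close> on the complex without it.\<close>

lemma koszul_d_decomp:
  assumes "avoids j u1" "j < q"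
  shows "koszul_d M q (u0 + wedge j u1)
    = (koszul_d M q u0 + fscale (M j) u1) + wedge j (- koszul_d M q u1)"
  using assms by (simp add: koszul_d_add koszul_d_wedge wedge_uminus)

text \<open>Generators are added one at a time; in the cone formula the two terms with
  \<open>M j\<close> cancel.\<close>

lemma koszul_d_square:
  assumes "finite I" "I \<subseteq> {..<q}" "v \<in> kchains n I i" "\<And>l. l < q \<Longrightarrow> M l \<in> polys n"
  shows "koszul_d M q (koszul_d M q v) = 0"
  using assms(1-3)
proof (induction I arbitrary: v i rule: finite_induct)
  case empty
  then have "koszul_d M q v = 0" by (auto simp: koszul_d_def kchains_def fun_eq_iff intro!: sum.neutral)
  then show ?case by (metis koszul_d_zero)
next
  case (insert j I)
  let ?d = "koszul_d M q"
  define u0 u1 where "u0 = part0 j v" and "u1 = part1 j v"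
  have u: "u0 \<in> kchains n I i" "u1 \<in> kchains n I (i - 1)"
    using insert by (auto simp: u0_def u1_def part0_kchains part1_kchains)
  then have d0: "?d (?d u0) = 0" "?d (?d u1) = 0" using insert by auto
  have "?d u1 \<in> kchains n I (i - 1 - 1)"
    by (rule koszul_d_kchains[OF insert.hyps(1) u(2) assms(4)])
  then have av: "avoids j u1" "avoids j (- ?d u1)"
    using kchains_avoids[OF u(2) insert.hyps(2)]
      kchains_avoids[OF fm.subm_uminus[OF subm_kchains] insert.hyps(2)] by blast+
  have "v = u0 + wedge j u1" unfolding u0_def u1_def by (rule part_decomp)
  then have "?d v = (?d u0 + fscale (M j) u1) + wedge j (- ?d u1)"
    using koszul_d_decomp[OF av(1)] insert.prems by simp
  then have "?d (?d v) = (?d (?d u0 + fscale (M j) u1) + fscale (M j) (- ?d u1)) + wedge j (- ?d (- ?d u1))"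
    using koszul_d_decomp[OF av(2)] insert.prems by simp
  then show ?case
    by (simp add: koszul_d_add koszul_d_fscale koszul_d_uminus d0 wedge_def fun_eq_iff)
qed

section \<open>Cycles and boundaries after adding one generator\<close>

locale koszul =
  fixes n q :: nat and M :: "nat \<Rightarrow> 'k::field pl"
  assumes M_polys: "\<And>l. l < q \<Longrightarrow> M l \<in> polys n"
begin

abbreviation "d \<equiv> koszul_d M q"
abbreviation "C \<equiv> (kchains n :: nat set \<Rightarrow> int \<Rightarrow> (nat set \<Rightarrow> 'k pl) set)"
abbreviation "Z \<equiv> kcycles n q M"
abbreviation "B \<equiv> kbounds n q M"

lemma C_add: "u \<in> C I i \<Longrightarrow> v \<in> C I i \<Longrightarrow> u + v \<in> C I i"
  and C_diff: "u \<in> C I i \<Longrightarrow> v \<in> C I i \<Longrightarrow> u - v \<in> C I i"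
  and C_uminus: "u \<in> C I i \<Longrightarrow> - u \<in> C I i"
  and C_fscale: "p \<in> polys n \<Longrightarrow> u \<in> C I i \<Longrightarrow> fscale p u \<in> C I i"
  using subm_kchains by (blast intro: fm.subm_add fm.subm_diff fm.subm_uminus fm.subm_scale)+

lemma d_C: "finite I \<Longrightarrow> u \<in> C I i \<Longrightarrow> d u \<in> C I (i - 1)"
  by (rule koszul_d_kchains) (auto intro: M_polys)

lemma C_insert: "u \<in> C I i \<Longrightarrow> u \<in> C (insert j I) i"
  using kchains_mono[of I "insert j I"] by blast

lemma subm_Z: "subm fscale (polys n) (Z I i)"
  unfolding subm_def kcycles_def
  using fm.subm_zero[OF subm_kchains]
  by (auto simp: koszul_d_zero koszul_d_add koszul_d_fscale C_add C_fscale)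

lemma subm_B: "subm fscale (polys n) (B I i)"
  unfolding subm_def
proof (intro conjI ballI)
  have "d 0 \<in> B I i" unfolding kbounds_def using fm.subm_zero[OF subm_kchains] by blast
  then show "0 \<in> B I i" by (simp only: koszul_d_zero)
  fix u assume "u \<in> B I i"
  then obtain y where y: "u = d y" "y \<in> C I (i + 1)" by (auto simp: kbounds_def)
  {
    fix v assume "v \<in> B I i"
    then obtain y' where "v = d y'" "y' \<in> C I (i + 1)" by (auto simp: kbounds_def)
    then have "u + v = d (y + y')" "y + y' \<in> C I (i + 1)" using y by (auto simp: koszul_d_add C_add)
    then show "u + v \<in> B I i" unfolding kbounds_def by blast
  }
  fix p :: "'k pl" assume "p \<in> polys n"
  then have "fscale p u = d (fscale p y)" "fscale p y \<in> C I (i + 1)"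
    using y by (auto simp: koszul_d_fscale C_fscale)
  then show "fscale p u \<in> B I i" unfolding kbounds_def by blast
qed

lemma B_subset_Z: "finite I \<Longrightarrow> I \<subseteq> {..<q} \<Longrightarrow> B I i \<subseteq> Z I i"
proof
  fix u assume I: "finite I" "I \<subseteq> {..<q}" and "u \<in> B I i"
  then obtain y where y: "u = d y" "y \<in> C I (i + 1)" by (auto simp: kbounds_def)
  then have "u \<in> C I i" using d_C[OF I(1) y(2)] by simp
  moreover have "d u = 0" unfolding y(1) using koszul_d_square[OF I y(2) M_polys] .
  ultimately show "u \<in> Z I i" by (simp add: kcycles_def)
qed

lemma wedge_C: "finite I \<Longrightarrow> j \<notin> I \<Longrightarrow> u \<in> C I (i - 1) \<Longrightarrow> wedge j u \<in> C (insert j I) i"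
  using wedge_kchains[of I u n "i - 1" j] by simp

lemma C_insertE:
  assumes "finite I" "j \<notin> I" "v \<in> C (insert j I) i"
  obtains u0 u1 where "v = u0 + wedge j u1" "u0 \<in> C I i" "u1 \<in> C I (i - 1)"
  using part_decomp[of v j] part0_kchains[OF assms(3)] part1_kchains[OF assms(1,3)] by blast

lemma d_decomp:
  assumes "j \<notin> I" "j < q" "u1 \<in> C I i"
  shows "d (u0 + wedge j u1) = (d u0 + fscale (M j) u1) + wedge j (- d u1)"
  using kchains_avoids[OF assms(3,1)] assms(2) by (rule koszul_d_decomp)

lemma decomp_eq_iff:
  assumes "j \<notin> I" "u0 \<in> C I a" "u1 \<in> C I b" "v0 \<in> C I a'" "v1 \<in> C I b'"
  shows "u0 + wedge j u1 = v0 + wedge j v1 \<longleftrightarrow> u0 = v0 \<and> u1 = v1"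
  using assms by (intro wedge_eq_iff kchains_avoids)

lemma wedge_zero: "wedge j (0 :: nat set \<Rightarrow> 'k pl) = 0"
  by (simp add: wedge_def fun_eq_iff)

lemma zero_C: "0 \<in> C I i"
  by (rule fm.subm_zero[OF subm_kchains])

lemma decomp_Z_iff:
  assumes I: "finite I" "j \<notin> I" "j < q" and u: "u0 \<in> C I i" "u1 \<in> C I (i - 1)"
  shows "u0 + wedge j u1 \<in> Z (insert j I) i \<longleftrightarrow> d u0 + fscale (M j) u1 = 0 \<and> d u1 = 0"
proof -
  have "d u0 + fscale (M j) u1 \<in> C I (i - 1)" "- d u1 \<in> C I (i - 1 - 1)"
    using u I C_uminus[OF d_C[OF I(1) u(2)]] by (auto intro!: C_add d_C C_fscale M_polys)
  then have "d (u0 + wedge j u1) = 0 + wedge j 0 \<longleftrightarrow> d u0 + fscale (M j) u1 = 0 \<and> - d u1 = 0"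
    unfolding d_decomp[OF I(2,3) u(2)] using zero_C by (intro decomp_eq_iff[OF I(2)])
  moreover have "u0 + wedge j u1 \<in> C (insert j I) i"
    using u I by (intro C_add wedge_C C_insert)
  ultimately show ?thesis by (simp only: wedge_zero kcycles_def) simp
qed

lemma insert_ZE:
  assumes I: "finite I" "j \<notin> I" "j < q" and v: "v \<in> Z (insert j I) i"
  obtains u0 u1 where "v = u0 + wedge j u1" "u0 \<in> C I i" "u1 \<in> C I (i - 1)"
    "d u0 + fscale (M j) u1 = 0" "d u1 = 0"
proof -
  have "v \<in> C (insert j I) i" using v by (simp add: kcycles_def)
  then obtain u0 u1 where u: "v = u0 + wedge j u1" "u0 \<in> C I i" "u1 \<in> C I (i - 1)"
    using C_insertE I by metis
  then show ?thesis using v decomp_Z_iff[OF I u(2,3)] that by blast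
qed

lemma insert_BE:
  assumes I: "finite I" "j \<notin> I" "j < q" and v: "v \<in> B (insert j I) i"
  obtains y0 y1 where "v = (d y0 + fscale (M j) y1) + wedge j (- d y1)" "y0 \<in> C I (i + 1)" "y1 \<in> C I i"
proof -
  obtain y where y: "v = d y" "y \<in> C (insert j I) (i + 1)" using v by (auto simp: kbounds_def)
  then obtain y0 y1 where "y = y0 + wedge j y1" "y0 \<in> C I (i + 1)" "y1 \<in> C I i"
    using C_insertE[OF I(1,2) y(2)] by auto
  then show ?thesis using that d_decomp[OF I(2,3)] y by blast
qed

lemma insert_BI:
  assumes I: "finite I" "j \<notin> I" "j < q" and y: "y0 \<in> C I (i + 1)" "y1 \<in> C I i"
  shows "(d y0 + fscale (M j) y1) + wedge j (- d y1) \<in> B (insert j I) i"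
proof -
  have "y0 + wedge j y1 \<in> C (insert j I) (i + 1)"
    using y I by (intro C_add wedge_C C_insert) auto
  then show ?thesis
    unfolding kbounds_def using d_decomp[OF I(2,3) y(2)] by (metis image_eqI)
qed

lemma Z_insert: "v \<in> Z I i \<Longrightarrow> v \<in> Z (insert j I) i"
  by (auto simp: kcycles_def C_insert)

text \<open>Exterior multiplication by the basis element of \<open>j\<close> is a homotopy from
  multiplication by \<open>M j\<close> to zero: for a cycle \<open>z\<close> with components
  \<open>u0\<close> and \<open>u1\<close>, the condition \<open>- d u0 = fscale (M j) u1\<close>
  identifies \<open>fscale (M j) z\<close> with the boundary of \<open>wedge j u0\<close>.\<close>

lemma generator_kills_homology:
  assumes I: "finite I" "j \<in> I" "I \<subseteq> {..<q}" and z: "z \<in> Z I i"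
  shows "fscale (M j) z \<in> B I i"
proof -
  let ?I = "I - {j}"
  have I': "finite ?I" "j \<notin> ?I" "j < q" and ins: "insert j ?I = I" using I by auto
  have "z \<in> Z (insert j ?I) i" using z ins by simp
  then obtain u0 u1 where u: "z = u0 + wedge j u1" "u0 \<in> C ?I i" "u1 \<in> C ?I (i - 1)"
    "d u0 + fscale (M j) u1 = 0" "d u1 = 0"
    using insert_ZE[OF I'] by metis
  have "- d u0 = fscale (M j) u1" using u(4) by (simp add: eq_neg_iff_add_eq_0 add.commute minus_equation_iff neg_eq_iff_add_eq_0)
  then have "fscale (M j) z = (d 0 + fscale (M j) u0) + wedge j (- d u0)"
    by (simp only: u(1) fm.scale_right_distrib wedge_fscale koszul_d_zero) simp
  also have "\<dots> \<in> B (insert j ?I) i" by (rule insert_BI[OF I' zero_C u(2)])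
  finally show ?thesis using ins by simp
qed

section \<open>The two induction steps for Koszul homology\<close>

text \<open>\<open>M g\<close> kills the homology over \<open>I\<close>, as \<open>M j\<close>
  divides it. Hence the long exact sequence of the cone breaks into short ones, and the homology in
  degree \<open>i\<close> over \<open>insert g I\<close> is an extension of that in degree
  \<open>i - 1\<close> over \<open>I\<close> by that in degree \<open>i\<close> over
  \<open>I\<close>.\<close>

lemma filtered_redundant:
  assumes I: "finite I" "g \<notin> I" "insert g I \<subseteq> {..<q}" and j: "j \<in> I"
    and c: "c \<in> polys n" "M g = c * M j"
    and f0: "filtered fscale (polys n) \<J> (B I i) (Z I i)"
    and f1: "filtered fscale (polys n) \<J> (B I (i - 1)) (Z I (i - 1))"
  shows "filtered fscale (polys n) \<J> (B (insert g I) i) (Z (insert g I) i)"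
proof -
  have g: "g < q" and I': "finite I" "g \<notin> I" "g < q" and Iq: "I \<subseteq> {..<q}" using I by auto
  have kill: "fscale (M g) z \<in> B I i" if "z \<in> Z I i" for z i
  proof -
    have "fscale c (fscale (M j) z) \<in> B I i"
      by (intro fm.subm_scale[OF subm_B] c generator_kills_homology I(1) Iq j that)
    then show ?thesis by (simp add: c(2))
  qed
  \<comment> \<open>Modulo boundaries, \<open>?K\<close> is the image of the homology over
    \<open>I\<close>.\<close>
  let ?K = "{v + l | v l. v \<in> Z I i \<and> l \<in> B (insert g I) i}"
  have "filtered fscale (polys n) \<J> (B (insert g I) i) ?K"
  proof (rule fm.filtered_image[where f = "\<lambda>v. v", OF f0 subm_B subm_B])
    fix v assume v: "v \<in> Z I i"
    then have vC: "v \<in> C I i" by (simp add: kcycles_def)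
    show "v \<in> B (insert g I) i \<longleftrightarrow> v \<in> B I i"
    proof
      assume "v \<in> B (insert g I) i"
      then obtain y0 y1 where y: "v = (d y0 + fscale (M g) y1) + wedge g (- d y1)"
        "y0 \<in> C I (i + 1)" "y1 \<in> C I i"
        using insert_BE[OF I'] by metis
      then have "v + wedge g 0 = (d y0 + fscale (M g) y1) + wedge g (- d y1)"
        by (simp add: wedge_zero)
      moreover have "d y0 + fscale (M g) y1 \<in> C I i" "- d y1 \<in> C I (i - 1)"
        using y I' d_C[OF I(1) y(2)] by (auto intro!: C_add d_C C_fscale M_polys C_uminus)
      ultimately have eq: "v = d y0 + fscale (M g) y1" "0 = - d y1"
        using decomp_eq_iff[OF I(2) vC zero_C] by blast+
      \<comment> \<open>The second component shows that \<open>y1\<close> is a cycle over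
        \<open>I\<close>, so \<open>M g\<close> times it bounds there; this gives
        injectivity.\<close>
      have "y1 \<in> Z I i" using y(3) eq(2) by (simp add: kcycles_def)
      then have "fscale (M g) y1 \<in> B I i" by (rule kill)
      moreover have "d y0 \<in> B I i" using y(2) by (auto simp: kbounds_def)
      ultimately show "v \<in> B I i" unfolding eq(1) by (intro fm.subm_add[OF subm_B])
    next
      assume "v \<in> B I i"
      then show "v \<in> B (insert g I) i" unfolding kbounds_def using C_insert by blast
    qed
  qed auto
  moreover have "filtered fscale (polys n) \<J> ?K (Z (insert g I) i)"
  proof -
    \<comment> \<open>To lift a cycle \<open>u\<close>, write \<open>fscale (M g) u = d y\<close>;
      then \<open>- y\<close> and \<open>u\<close> are the components of a cycle.\<close>
    have surj: "Z I (i - 1) \<subseteq> part1 g ` Z (insert g I) i"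
    proof
      fix u assume u: "u \<in> Z I (i - 1)"
      then have uC: "u \<in> C I (i - 1)" "d u = 0" by (auto simp: kcycles_def)
      obtain y where y: "fscale (M g) u = d y" "y \<in> C I i"
        using kill[OF u] by (auto simp: kbounds_def)
      have "- y + wedge g u \<in> Z (insert g I) i"
        using y uC by (subst decomp_Z_iff[OF I']) (auto intro: C_uminus simp: koszul_d_uminus)
      moreover have "part1 g (- y + wedge g u) = u"
        using y uC I' by (intro part1_wedge kchains_avoids[OF C_uminus] kchains_avoids[OF uC(1)])
      ultimately show "u \<in> part1 g ` Z (insert g I) i" by force
    qed
    have "filtered fscale (polys n) \<J> {v \<in> Z (insert g I) i. part1 g v \<in> B I (i - 1)}
        {v \<in> Z (insert g I) i. part1 g v \<in> Z I (i - 1)}"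
      by (rule fm.filtered_vimage[OF f1 subm_B subm_Z part1_add part1_fscale surj])
    moreover have "{v \<in> Z (insert g I) i. part1 g v \<in> Z I (i - 1)} = Z (insert g I) i"
    proof -
      have "part1 g v \<in> Z I (i - 1)" if v: "v \<in> Z (insert g I) i" for v
      proof -
        obtain u0 u1 where u: "v = u0 + wedge g u1" "u0 \<in> C I i" "u1 \<in> C I (i - 1)" "d u1 = 0"
          using insert_ZE[OF I' v] by metis
        then have "part1 g v = u1" using I' by (auto intro: part1_wedge kchains_avoids)
        then show ?thesis using u by (simp add: kcycles_def)
      qed
      then show ?thesis by blast
    qed
    \<comment> \<open>Exactness in the middle: if the second component is \<open>d y\<close>,
      subtracting a boundary removes it and leaves a cycle over \<open>I\<close>.\<close>
    moreover have "{v \<in> Z (insert g I) i. part1 g v \<in> B I (i - 1)} = ?K"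
    proof
      show "{v \<in> Z (insert g I) i. part1 g v \<in> B I (i - 1)} \<subseteq> ?K"
      proof clarify
        fix v assume v: "v \<in> Z (insert g I) i" "part1 g v \<in> B I (i - 1)"
        obtain u0 u1 where u: "v = u0 + wedge g u1" "u0 \<in> C I i" "u1 \<in> C I (i - 1)"
            "d u0 + fscale (M g) u1 = 0" "d u1 = 0"
          using insert_ZE[OF I' v(1)] by metis
        then have "part1 g v = u1" using I' by (auto intro: part1_wedge kchains_avoids)
        then obtain y where y: "u1 = d y" "y \<in> C I i" using v(2) by (auto simp: kbounds_def)
        define l where "l = (d 0 + fscale (M g) (- y)) + wedge g (- d (- y))"
        have l: "l \<in> B (insert g I) i"
          unfolding l_def by (rule insert_BI[OF I' zero_C C_uminus[OF y(2)]])
        have "v - l = u0 + fscale (M g) y"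
          by (simp only: l_def u(1) y(1) koszul_d_zero koszul_d_uminus) simp
        moreover have "u0 + fscale (M g) y \<in> C I i"
          using u y g by (intro C_add C_fscale M_polys)
        moreover have "d (u0 + fscale (M g) y) = 0"
          using u(4) y by (simp only: koszul_d_add koszul_d_fscale)
        ultimately have "v - l \<in> Z I i" by (simp add: kcycles_def)
        moreover have "v = (v - l) + l" by simp
        ultimately show "\<exists>v' l. v = v' + l \<and> v' \<in> Z I i \<and> l \<in> B (insert g I) i"
          using l by blast
      qed
      show "?K \<subseteq> {v \<in> Z (insert g I) i. part1 g v \<in> B I (i - 1)}"
      proof clarify
        fix v l assume v: "v \<in> Z I i" and l: "l \<in> B (insert g I) i"
        have vl: "v + l \<in> Z (insert g I) i"
          using Z_insert[OF v] B_subset_Z[OF _ I(3)] I(1) l by (intro fm.subm_add[OF subm_Z]) auto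
        obtain y0 y1 where y: "l = (d y0 + fscale (M g) y1) + wedge g (- d y1)"
          "y0 \<in> C I (i + 1)" "y1 \<in> C I i"
          using insert_BE[OF I' l] by metis
        have "v + l = (v + (d y0 + fscale (M g) y1)) + wedge g (- d y1)"
          unfolding y(1) by (simp only: add.assoc)
        moreover have "v + (d y0 + fscale (M g) y1) \<in> C I i"
          using y v d_C[OF I(1) y(2)] g by (auto intro!: C_add C_fscale M_polys simp: kcycles_def)
        moreover have dy: "- d y1 \<in> C I (i - 1)" using y I by (intro C_uminus d_C)
        ultimately have "part1 g (v + l) = - d y1"
          using I' by (simp only:) (intro part1_wedge kchains_avoids)
        also have "\<dots> = d (- y1)" by (simp only: koszul_d_uminus)
        also have "\<dots> \<in> B I (i - 1)" unfolding kbounds_def using C_uminus[OF y(3)] by simp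
        finally show "v + l \<in> Z (insert g I) i \<and> part1 g (v + l) \<in> B I (i - 1)" using vl by blast
      qed
    qed
    ultimately show ?thesis by simp
  qed
  ultimately show ?thesis by (rule filtered_trans[rotated])
qed

text \<open>The map \<open>\<phi>\<close> multiplies the components without \<open>j\<close> by
  \<open>x\<close>; it is a chain map from the complex with \<open>m\<close> in place of
  \<open>M j\<close> to that of \<open>M\<close>. Regularity of \<open>x\<close> on the homology
  over \<open>I\<close> makes it injective on homology, with cokernel the homology over
  \<open>I\<close> modulo \<open>x\<close>.\<close>

lemma filtered_free_variable:
  assumes I: "finite I" "j \<notin> I" "insert j I \<subseteq> {..<q}"
    and x: "x \<in> polys n" and m: "m \<in> polys n" "M j = x * m"
    and reg: "\<And>i. regular_on fscale (Z I i) (B I i) x"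
    and f0: "filtered fscale (polys n) \<J> (kbounds n q (M(j := m)) (insert j I) i)
        (kcycles n q (M(j := m)) (insert j I) i)"
    and f1: "filtered fscale (polys n) \<J> (addm fscale (B I i) x (Z I i)) (Z I i)"
  shows "filtered fscale (polys n) \<J> (B (insert j I) i) (Z (insert j I) i)"
proof -
  interpret K': koszul n q "M(j := m)"
    by standard (use M_polys m in auto)
  have jq: "j < q" and I': "finite I" "j \<notin> I" "j < q" using I by auto
  let ?d' = "koszul_d (M(j := m)) q"
  have d': "?d' u = d u" if "u \<in> C I a" for u a
    using that I by (intro koszul_d_cong[where I = I]) auto
  have Mj: "fscale (M j) u = fscale x (fscale m u)" for u by (simp add: m(2))
  define \<phi> where "\<phi> v = (\<lambda>T. if j \<in> T then v T else x * v T)" for v :: "nat set \<Rightarrow> 'k pl"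
  have \<phi>: "\<phi> (u0 + wedge j u1) = fscale x u0 + wedge j u1" if "u0 \<in> C I a" for u0 u1 a
    using kchains_avoids[OF that I(2)]
    by (auto simp: \<phi>_def fun_eq_iff avoids_def wedge_def fscale_def)
  have \<phi>_add: "\<phi> (u + v) = \<phi> u + \<phi> v" and \<phi>_scale: "\<phi> (fscale p v) = fscale p (\<phi> v)" for u v p
    by (auto simp: \<phi>_def fun_eq_iff fscale_def algebra_simps)
  let ?K = "{\<phi> v + l | v l. v \<in> K'.Z (insert j I) i \<and> l \<in> B (insert j I) i}"
  have fK: "filtered fscale (polys n) \<J> (B (insert j I) i) ?K"
  proof (rule fm.filtered_image[OF f0 K'.subm_B subm_B \<phi>_add \<phi>_scale])
    fix z assume z: "z \<in> K'.Z (insert j I) i"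
    obtain z0 z1 where z01: "z = z0 + wedge j z1" "z0 \<in> C I i" "z1 \<in> C I (i - 1)"
      and dz: "d z0 + fscale m z1 = 0" "d z1 = 0"
      using K'.insert_ZE[OF I' z] d' by (metis fun_upd_same)
    show "\<phi> z \<in> B (insert j I) i \<longleftrightarrow> z \<in> K'.B (insert j I) i"
    proof
      assume "\<phi> z \<in> B (insert j I) i"
      then obtain y0 y1 where y: "\<phi> z = (d y0 + fscale (M j) y1) + wedge j (- d y1)"
        "y0 \<in> C I (i + 1)" "y1 \<in> C I i"
        using insert_BE[OF I'] by metis
      have C: "d y0 + fscale (M j) y1 \<in> C I i" "- d y1 \<in> C I (i - 1)"
        using y I' d_C[OF I(1) y(2)] by (auto intro!: C_add d_C C_fscale M_polys C_uminus)
      have eq: "fscale x z0 = d y0 + fscale (M j) y1" "z1 = - d y1"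
        using y(1) decomp_eq_iff[OF I(2) C_fscale[OF x z01(2)] z01(3) C]
        unfolding z01(1) \<phi>[OF z01(2)] by blast+
      \<comment> \<open>\<open>t\<close> is what remains of \<open>z\<close> after subtracting the
        boundary of \<open>wedge j y1\<close> in the complex with \<open>m\<close>. It is a cycle
        over \<open>I\<close> and \<open>fscale x t\<close> bounds, hence \<open>t\<close>
        bounds.\<close>
      define t where "t = z0 - fscale m y1"
      have t: "fscale x t = d y0"
        unfolding t_def fm.scale_right_diff_distrib eq(1) Mj by simp
      have "d t = d z0 + fscale m z1"
        unfolding t_def koszul_d_diff koszul_d_fscale eq(2) by simp
      then have "t \<in> Z I i"
        using dz z01 y(3) m by (auto simp: kcycles_def t_def intro!: C_diff C_fscale)
      moreover have "fscale x t \<in> B I i" unfolding t kbounds_def using y(2) by blast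
      ultimately have "t \<in> B I i" using reg by (auto simp: regular_on_def)
      then obtain y' where y': "t = d y'" "y' \<in> C I (i + 1)" by (auto simp: kbounds_def)
      have "z = (?d' y' + fscale ((M(j := m)) j) y1) + wedge j (- ?d' y1)"
        unfolding z01(1) eq(2) d'[OF y(3)] d'[OF y'(2)] y'(1)[symmetric] by (simp add: t_def)
      also have "\<dots> \<in> K'.B (insert j I) i" by (rule K'.insert_BI[OF I' y'(2) y(3)])
      finally show "z \<in> K'.B (insert j I) i" .
    next
      assume "z \<in> K'.B (insert j I) i"
      then obtain y0 y1 where y: "z = (?d' y0 + fscale ((M(j := m)) j) y1) + wedge j (- ?d' y1)"
        "y0 \<in> C I (i + 1)" "y1 \<in> C I i"
        using K'.insert_BE[OF I'] by metis
      have "z = (d y0 + fscale m y1) + wedge j (- d y1)"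
        unfolding y(1) d'[OF y(2)] d'[OF y(3)] by simp
      moreover have "d y0 + fscale m y1 \<in> C I i"
        using y d_C[OF I(1) y(2)] m by (auto intro!: C_add C_fscale)
      ultimately have "\<phi> z = (d (fscale x y0) + fscale (M j) y1) + wedge j (- d y1)"
        using \<phi> by (simp add: fm.scale_right_distrib koszul_d_fscale Mj)
      also have "\<dots> \<in> B (insert j I) i" by (rule insert_BI[OF I' C_fscale[OF x y(2)] y(3)])
      finally show "\<phi> z \<in> B (insert j I) i" .
    qed
  qed
  have K: "subm fscale (polys n) ?K" by (rule fm.filtered_subm[OF fK subm_B])
  have KZ: "?K \<subseteq> Z (insert j I) i"
  proof clarify
    fix z l assume z: "z \<in> K'.Z (insert j I) i" and l: "l \<in> B (insert j I) i"
    obtain z0 z1 where z01: "z = z0 + wedge j z1" "z0 \<in> C I i" "z1 \<in> C I (i - 1)"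
      and dz: "d z0 + fscale m z1 = 0" "d z1 = 0"
      using K'.insert_ZE[OF I' z] d' by (metis fun_upd_same)
    have "d (fscale x z0) + fscale (M j) z1 = fscale x (d z0 + fscale m z1)"
      by (simp add: koszul_d_fscale Mj fm.scale_right_distrib)
    also have "\<dots> = 0" by (simp only: dz fm.scale_zero_right)
    finally have "\<phi> z \<in> Z (insert j I) i"
      unfolding z01(1) \<phi>[OF z01(2)] using decomp_Z_iff[OF I' C_fscale[OF x z01(2)] z01(3)] dz(2) by blast
    then show "\<phi> z + l \<in> Z (insert j I) i"
      using l B_subset_Z[OF _ I(3)] I(1) by (intro fm.subm_add[OF subm_Z]) auto
  qed
  \<comment> \<open>The cokernel is represented by cycles over \<open>I\<close>, and those lying in
    \<open>?K\<close> are exactly the ones trivial in the homology over \<open>I\<close> modulo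
    \<open>x\<close>.\<close>
  have fZ: "filtered fscale (polys n) \<J> ?K {v + l | v l. v \<in> Z I i \<and> l \<in> ?K}"
  proof (rule fm.filtered_image[where f = "\<lambda>v. v", OF f1 fm.subm_addm[OF subm_B subm_Z] K])
    fix v assume v: "v \<in> Z I i"
    then have vC: "v \<in> C I i" by (simp add: kcycles_def)
    show "v \<in> ?K \<longleftrightarrow> v \<in> addm fscale (B I i) x (Z I i)"
    proof
      assume "v \<in> ?K"
      then obtain a l where al: "v = \<phi> a + l" "a \<in> K'.Z (insert j I) i" "l \<in> B (insert j I) i"
        by blast
      obtain a0 a1 where a: "a = a0 + wedge j a1" "a0 \<in> C I i" "a1 \<in> C I (i - 1)"
        and da: "d a0 + fscale m a1 = 0" "d a1 = 0"
        using K'.insert_ZE[OF I' al(2)] d' by (metis fun_upd_same)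
      obtain y0 y1 where y: "l = (d y0 + fscale (M j) y1) + wedge j (- d y1)"
        "y0 \<in> C I (i + 1)" "y1 \<in> C I i"
        using insert_BE[OF I' al(3)] by metis
      have "v + wedge j 0 = (fscale x a0 + (d y0 + fscale (M j) y1)) + wedge j (a1 + - d y1)"
        unfolding al(1) a(1) \<phi>[OF a(2)] y(1) wedge_add wedge_zero by (simp only: ac_simps add_0_right add_0_left)
      moreover have "fscale x a0 + (d y0 + fscale (M j) y1) \<in> C I i"
        using a y d_C[OF I(1) y(2)] jq by (intro C_add C_fscale M_polys x) auto
      moreover have "a1 + - d y1 \<in> C I (i - 1)"
        using a y I by (intro C_add C_uminus d_C)
      ultimately have eq: "v = fscale x a0 + (d y0 + fscale (M j) y1)" "0 = a1 + - d y1"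
        using decomp_eq_iff[OF I(2) vC zero_C] by blast+
      have a1: "a1 = d y1" using eq(2) by simp
      \<comment> \<open>Since \<open>M j = x * m\<close>, both \<open>fscale x a0\<close> and
        \<open>fscale (M j) y1\<close> are multiples of \<open>x\<close>; their sum is
        \<open>fscale x t\<close>, with \<open>t\<close> a cycle because the second component of
        \<open>v\<close> vanishes.\<close>
      define t where "t = a0 + fscale m y1"
      have "d t = d a0 + fscale m a1"
        unfolding t_def koszul_d_add koszul_d_fscale a1 ..
      then have t: "t \<in> Z I i"
        using da a y m by (auto simp: kcycles_def t_def intro!: C_add C_fscale)
      have "v = d y0 + fscale x t"
        unfolding eq(1) t_def Mj fm.scale_right_distrib by simp
      moreover have "d y0 \<in> B I i" unfolding kbounds_def using y(2) by blast
      ultimately show "v \<in> addm fscale (B I i) x (Z I i)" unfolding addm_def using t by blast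
    next
      assume "v \<in> addm fscale (B I i) x (Z I i)"
      then obtain l t where lt: "v = l + fscale x t" "l \<in> B I i" "t \<in> Z I i"
        by (auto simp: addm_def)
      have tC: "t \<in> C I i" "d t = 0" using lt by (auto simp: kcycles_def)
      have "t \<in> K'.Z (insert j I) i"
        using tC d'[OF tC(1)] by (auto simp: kcycles_def intro: C_insert)
      moreover have "l \<in> B (insert j I) i"
        using lt(2) C_insert unfolding kbounds_def by blast
      moreover have "\<phi> t = fscale x t"
        using \<phi>[OF tC(1), of 0] by (simp add: wedge_zero)
      then have "v = \<phi> t + l" using lt(1) by (simp add: add.commute)
      ultimately show "v \<in> ?K" by blast
    qed
  qed auto
  have "{v + l | v l. v \<in> Z I i \<and> l \<in> ?K} = Z (insert j I) i"
  proof
    show "{v + l | v l. v \<in> Z I i \<and> l \<in> ?K} \<subseteq> Z (insert j I) i"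
    proof
      fix u assume "u \<in> {v + l | v l. v \<in> Z I i \<and> l \<in> ?K}"
      then obtain v l where "u = v + l" "v \<in> Z I i" "l \<in> ?K" by blast
      moreover from this have "l \<in> Z (insert j I) i" using KZ by blast
      ultimately show "u \<in> Z (insert j I) i"
        using Z_insert fm.subm_add[OF subm_Z] by simp
    qed
    show "Z (insert j I) i \<subseteq> {v + l | v l. v \<in> Z I i \<and> l \<in> ?K}"
    proof
      fix z assume z: "z \<in> Z (insert j I) i"
      obtain z0 z1 where z01: "z = z0 + wedge j z1" "z0 \<in> C I i" "z1 \<in> C I (i - 1)"
        and dz: "d z0 + fscale (M j) z1 = 0" "d z1 = 0"
        using insert_ZE[OF I' z] by metis
      \<comment> \<open>\<open>x\<close> multiplies this cycle to the boundary of
        \<open>- z0\<close>, so regularity in degree \<open>i - 1\<close> gives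
        \<open>fscale m z1 = d y\<close>. Then \<open>z\<close> is the cycle
        \<open>z0 + fscale x y\<close> over \<open>I\<close> plus the image under
        \<open>\<phi>\<close> of \<open>- y + wedge j z1\<close>.\<close>
      have "fscale m z1 \<in> Z I (i - 1)"
        using z01 dz m by (auto simp: kcycles_def koszul_d_fscale intro!: C_fscale)
      moreover have "fscale x (fscale m z1) \<in> B I (i - 1)"
      proof -
        have "fscale x (fscale m z1) = d (- z0)"
          using dz(1) unfolding Mj koszul_d_uminus by (simp add: eq_neg_iff_add_eq_0 add.commute)
        then show ?thesis unfolding kbounds_def using C_uminus[OF z01(2)] by simp
      qed
      ultimately have "fscale m z1 \<in> B I (i - 1)" using reg by (auto simp: regular_on_def)
      then obtain y where y: "fscale m z1 = d y" "y \<in> C I i" by (auto simp: kbounds_def)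
      let ?v = "z0 + fscale x y" and ?a = "- y + wedge j z1"
      have "d ?v = d z0 + fscale (M j) z1"
        unfolding koszul_d_add koszul_d_fscale y(1)[symmetric] Mj ..
      then have v: "?v \<in> Z I i"
        using dz z01 y x by (auto simp: kcycles_def intro!: C_add C_fscale)
      have "?d' (- y) + fscale ((M(j := m)) j) z1 = 0" "?d' z1 = 0"
        unfolding koszul_d_uminus d'[OF y(2)] d'[OF z01(3)] using y(1) dz(2) by simp_all
      then have "?a \<in> K'.Z (insert j I) i"
        using K'.decomp_Z_iff[OF I' C_uminus[OF y(2)] z01(3)] by blast
      then have "\<phi> ?a + 0 \<in> ?K" using fm.subm_zero[OF subm_B] by blast
      moreover have "z = ?v + (\<phi> ?a + 0)"
        unfolding \<phi>[OF C_uminus[OF y(2)]] z01(1) by simp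
      ultimately show "z \<in> {v + l | v l. v \<in> Z I i \<and> l \<in> ?K}" using v by blast
    qed
  qed
  then show ?thesis using filtered_trans[OF _ fK] fZ by simp
qed

end

section \<open>Facet ideals of forests\<close>

text \<open>Leaves are taken among indices, not sets, so that members may be nested or equal: of two
  equal members each serves as the joint of the other.\<close>

definition leaf_family :: "(nat \<Rightarrow> nat set) \<Rightarrow> nat set \<Rightarrow> bool" where
  "leaf_family A I \<longleftrightarrow> (\<forall>J. J \<subseteq> I \<and> J \<noteq> {} \<longrightarrow>
    (\<exists>j\<in>J. J = {j} \<or> (\<exists>g\<in>J. g \<noteq> j \<and> (\<forall>l\<in>J. l \<noteq> j \<longrightarrow> A j \<inter> A l \<subseteq> A g))))"

lemma leaf_family_subset: "leaf_family A I \<Longrightarrow> J \<subseteq> I \<Longrightarrow> leaf_family A J"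
  unfolding leaf_family_def by (intro allI impI) (drule spec, erule mp, auto)

text \<open>As \<open>w\<close> lies in no member except possibly that of \<open>j\<close>, it lies
  in no intersection of members with different indices, so deleting it changes no such
  intersection.\<close>

lemma leaf_family_remove_free_vertex:
  assumes "leaf_family A I" "\<And>l. l \<in> I \<Longrightarrow> l \<noteq> j \<Longrightarrow> w \<notin> A l"
  shows "leaf_family (A(j := A j - {w})) I"
  unfolding leaf_family_def
proof (intro allI impI)
  let ?A = "A(j := A j - {w})"
  fix J assume J: "J \<subseteq> I \<and> J \<noteq> {}"
  then obtain k where k: "k \<in> J" "J = {k} \<or> (\<exists>g\<in>J. g \<noteq> k \<and> (\<forall>l\<in>J. l \<noteq> k \<longrightarrow> A k \<inter> A l \<subseteq> A g))"
    using assms(1)[unfolded leaf_family_def, rule_format, OF J] by (elim bexE)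
  have "?A k \<inter> ?A l \<subseteq> ?A g" if "A k \<inter> A l \<subseteq> A g" "g \<in> J" "l \<in> J" "g \<noteq> k" "l \<noteq> k" for g l
  proof -
    have "w \<notin> A k \<or> k = j" "w \<notin> A l \<or> l = j" using that J k(1) assms(2) by blast+
    then show ?thesis using that by (cases "g = j"; cases "k = j"; cases "l = j") auto
  qed
  then have "J = {k} \<or> (\<exists>g\<in>J. g \<noteq> k \<and> (\<forall>l\<in>J. l \<noteq> k \<longrightarrow> ?A k \<inter> ?A l \<subseteq> ?A g))"
    using k(2) by meson
  then show "\<exists>k\<in>J. J = {k} \<or> (\<exists>g\<in>J. g \<noteq> k \<and> (\<forall>l\<in>J. l \<noteq> k \<longrightarrow> ?A k \<inter> ?A l \<subseteq> ?A g))"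
    by (rule bexI[OF _ k(1)])
qed

text \<open>With \<open>c\<close> generators, at most \<open>c - i\<close> variables vanish on a
  quotient in degree \<open>i\<close>, which for \<open>U\<close> inside \<open>{..<n}\<close>
  leaves dimension at least \<open>n - c + i\<close>. The set \<open>U\<close> confines these
  variables to the vertices of the family.\<close>

definition pieces :: "nat \<Rightarrow> nat set \<Rightarrow> nat \<Rightarrow> int \<Rightarrow> 'k::field pl set set" where
  "pieces n U c i = {var_ideal n S | S. S \<subseteq> U \<and> int (card S) + i \<le> int c}"

lemma pieces_mono: "U \<subseteq> U' \<Longrightarrow> int c - i \<le> int c' - i' \<Longrightarrow> pieces n U c i \<subseteq> pieces n U' c' i'"
  unfolding pieces_def by force

text \<open>Without generators the complex is the ring placed in degree 0, a single cyclic piece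
  with zero annihilator.\<close>

lemma filtered_koszul_empty:
  "filtered fscale (polys n) (pieces n {} 0 i) (kbounds n q M {} i) (kcycles n q M {} i)"
proof -
  have d: "koszul_d M q v = 0" if "v \<in> kchains n {} a" for v a
    using that by (auto simp: koszul_d_def kchains_def fun_eq_iff intro!: sum.neutral)
  have B: "kbounds n q M {} i = {0}"
  proof -
    have "kchains n {} (i + 1) \<noteq> ({} :: (nat set \<Rightarrow> 'a pl) set)"
      using fm.subm_zero[OF subm_kchains] by blast
    then show ?thesis unfolding kbounds_def using d by auto
  qed
  have Z: "kcycles n q M {} i = kchains n {} i" unfolding kcycles_def using d by blast
  show ?thesis
  proof (cases "i = 0")
    case False
    then have "kchains n {} i = {0 :: nat set \<Rightarrow> 'a pl}"
      by (auto simp: kchains_def fun_eq_iff polys.R_zero) (metis card.empty of_nat_0 subset_empty)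
    then show ?thesis unfolding B Z by (metis filtered_refl)
  next
    case True
    define e :: "nat set \<Rightarrow> 'a pl" where "e = (\<lambda>T. if T = {} then 1 else 0)"
    have e: "fscale p e = (\<lambda>T. if T = {} then p else 0)" for p
      by (auto simp: e_def fscale_def)
    have "{p \<in> polys n. fscale p e \<in> {0}} = var_ideal n {}"
      unfolding var_ideal_empty e by (auto simp: fun_eq_iff polys.R_zero split: if_splits)
    moreover have "var_ideal n {} \<in> pieces n {} 0 i"
      unfolding pieces_def using True by auto
    moreover have "kchains n {} i = cyc fscale (polys n) {0} e"
    proof
      show "kchains n {} i \<subseteq> cyc fscale (polys n) {0} e"
      proof
        fix v :: "nat set \<Rightarrow> 'a pl" assume v: "v \<in> kchains n {} i"
        then have "v = 0 + fscale (v {}) e" "v {} \<in> polys n"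
          unfolding e by (auto simp: kchains_def fun_eq_iff)
        then show "v \<in> cyc fscale (polys n) {0} e" unfolding cyc_def by blast
      qed
      show "cyc fscale (polys n) {0} e \<subseteq> kchains n {} i"
        unfolding cyc_def e using True by (auto simp: kchains_def polys.R_zero split: if_splits)
    qed
    ultimately show ?thesis unfolding B Z by (rule filtered_stepI[OF filtered_refl])
  qed
qed

text \<open>Induction on the total size of the members plus their number. The number is included
  because a removed member may be empty; deleting a free vertex keeps the number but shrinks a
  member.\<close>

lemma koszul_filtered:
  assumes "finite I" "I \<subseteq> {..<q}" "\<And>l. l < q \<Longrightarrow> A l \<subseteq> {..<n}" "leaf_family A I"
  shows "filtered fscale (polys n) (pieces n (\<Union>(A ` I)) (card I) i)
    (kbounds n q (\<lambda>l. facet_monomial (A l) :: 'k::field pl) I i)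
    (kcycles n q (\<lambda>l. facet_monomial (A l)) I i)"
  using assms
proof (induction "(\<Sum>l\<in>I. card (A l)) + card I" arbitrary: A I i rule: less_induct)
  case less
  note I = less.prems(1,2) and A = less.prems(3)
  define M :: "nat \<Rightarrow> 'k pl" where "M = (\<lambda>l. facet_monomial (A l))"
  interpret koszul n q M by standard (simp add: M_def A facet_monomial_polys)
  have finA: "finite (A l)" if "l < q" for l using A[OF that] finite_subset by blast
  have IH: "filtered fscale (polys n) (pieces n (\<Union>(A ` (I - {k}))) (card (I - {k})) i)
      (B (I - {k}) i) (Z (I - {k}) i)" if "k \<in> I" for k i
    unfolding M_def
  proof (rule less.hyps)
    have "(\<Sum>l\<in>I - {k}. card (A l)) \<le> (\<Sum>l\<in>I. card (A l))" using I by (intro sum_mono2) auto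
    moreover have "card (I - {k}) < card I" using that I by (intro psubset_card_mono) auto
    ultimately show "(\<Sum>l\<in>I - {k}. card (A l)) + card (I - {k}) < (\<Sum>l\<in>I. card (A l)) + card I" by simp
    show "leaf_family A (I - {k})" by (rule leaf_family_subset[OF less.prems(4)]) blast
  qed (use I A in auto)
  have "filtered fscale (polys n) (pieces n (\<Union>(A ` I)) (card I) i) (B I i) (Z I i)"
  proof (cases "I = {}")
    case True
    then show ?thesis using filtered_koszul_empty by simp
  next
    case False
    then obtain j where j: "j \<in> I"
      and leaf: "I = {j} \<or> (\<exists>g\<in>I. g \<noteq> j \<and> (\<forall>l\<in>I. l \<noteq> j \<longrightarrow> A j \<inter> A l \<subseteq> A g))"
      using less.prems(4)[unfolded leaf_family_def, rule_format, of I] by auto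
    have jq: "j < q" using j I by auto
    have card_I: "card I = Suc (card (I - {k}))" if "k \<in> I" for k
      using card.remove[OF I(1) that] .
    have ins: "insert k (I - {k}) = I" if "k \<in> I" for k using that by blast
    show ?thesis
    \<comment> \<open>Either the leaf \<open>j\<close> has a vertex \<open>w\<close> of its own, or
      it is the only member and empty, or it is contained in its joint \<open>g\<close>.\<close>
    proof (cases "\<exists>w\<in>A j. \<forall>l\<in>I. l \<noteq> j \<longrightarrow> w \<notin> A l")
      case True
      then obtain w where w: "w \<in> A j" "\<And>l. l \<in> I \<Longrightarrow> l \<noteq> j \<Longrightarrow> w \<notin> A l" by blast
      have wn: "w < n" using w A[OF jq] by auto
      let ?A = "A(j := A j - {w})" and ?x = "facet_monomial {w} :: 'k pl" and ?m = "facet_monomial (A j - {w}) :: 'k pl"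
      let ?J = "pieces n (\<Union>(A ` I)) (card I) i"
      have x: "?x \<in> polys n" using wn by (intro facet_monomial_polys) auto
      have m: "?m \<in> polys n" using A[OF jq] by (intro facet_monomial_polys) auto
      have Mj: "M j = ?x * ?m"
        using facet_monomial_insert[of "A j - {w}" w, where 'a = 'k] finA[OF jq] insert_Diff[OF w(1)]
        by (simp add: M_def del: insert_Diff_single)
      have reg: "regular_on (*) (polys n) J ?x"
        if J: "J \<in> pieces n (\<Union>(A ` (I - {j}))) c a" for J :: "'k pl set" and c a
      proof -
        obtain S where "J = var_ideal n S" "S \<subseteq> \<Union>(A ` (I - {j}))" using J by (auto simp: pieces_def)
        moreover from this have "w \<notin> S" using w(2) by blast
        ultimately show ?thesis by (simp only: regular_on_var_ideal not_False_eq_True)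
      qed
      have "filtered fscale (polys n) ?J (B (insert j (I - {j})) i) (Z (insert j (I - {j})) i)"
      proof (rule filtered_free_variable[OF _ _ _ x m Mj])
        show "regular_on fscale (Z (I - {j}) a) (B (I - {j}) a) ?x" for a
          by (rule fm.filtered_regular_on[OF IH[OF j] subm_B x reg])
        have 1: "filtered fscale (polys n) (pieces n (\<Union>(?A ` I)) (card I) i)
            (kbounds n q (\<lambda>l. facet_monomial (?A l) :: 'k pl) I i) (kcycles n q (\<lambda>l. facet_monomial (?A l)) I i)"
        proof (rule less.hyps)
          have "card (A j - {w}) < card (A j)" by (rule card_Diff1_less[OF finA[OF jq] w(1)])
          moreover have "(\<Sum>l\<in>I. card (?A l)) = card (A j - {w}) + (\<Sum>l\<in>I - {j}. card (A l))"
            by (subst sum.remove[OF I(1) j]) (auto intro!: sum.cong)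
          moreover have "(\<Sum>l\<in>I. card (A l)) = card (A j) + (\<Sum>l\<in>I - {j}. card (A l))"
            by (rule sum.remove[OF I(1) j])
          ultimately show "(\<Sum>l\<in>I. card (?A l)) + card I < (\<Sum>l\<in>I. card (A l)) + card I" by simp
          show "leaf_family ?A I" by (rule leaf_family_remove_free_vertex[OF less.prems(4) w(2)])
          show "?A l \<subseteq> {..<n}" if "l < q" for l using A[OF that] A[OF jq] by auto
        qed (use I in auto)
        have 2: "(\<lambda>l. facet_monomial (?A l) :: 'k pl) = M(j := ?m)" by (auto simp: M_def)
        have 3: "pieces n (\<Union>(?A ` I)) (card I) i \<subseteq> (?J :: 'k pl set set)"
          using j by (intro pieces_mono) (auto split: if_splits)
        show "filtered fscale (polys n) ?J (kbounds n q (M(j := ?m)) (insert j (I - {j})) i)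
            (kcycles n q (M(j := ?m)) (insert j (I - {j})) i)"
          unfolding ins[OF j] using filtered_mono[OF 1 3] unfolding 2 .
        show "filtered fscale (polys n) ?J (addm fscale (B (I - {j}) i) ?x (Z (I - {j}) i)) (Z (I - {j}) i)"
        proof (rule fm.filtered_addm_self[OF IH[OF j] subm_B x reg])
          fix J :: "'k pl set" assume "J \<in> pieces n (\<Union>(A ` (I - {j}))) (card (I - {j})) i"
          then obtain S where S: "J = var_ideal n S" "S \<subseteq> \<Union>(A ` (I - {j}))"
            "int (card S) + i \<le> int (card (I - {j}))" by (auto simp: pieces_def)
          have "addm (*) J ?x (polys n) = var_ideal n (insert w S)"
            unfolding S(1) by (rule addm_var_ideal[OF wn])
          moreover have "insert w S \<subseteq> \<Union>(A ` I)" using S(2) w(1) j by auto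
          \<comment> \<open>The additional variable is paid for by the generator \<open>j\<close>,
            which the family without \<open>j\<close> lacks.\<close>
          moreover have "int (card (insert w S)) + i \<le> int (card I)"
            using S(3) card_insert_le_m1[of "Suc (card S)" S w] card_I[OF j] by linarith
          ultimately show "addm (*) J ?x (polys n) \<in> ?J" unfolding pieces_def by blast
        qed
      qed (use I j in auto)
      then show ?thesis unfolding ins[OF j] .
    next
      case False
      show ?thesis
      proof (cases "I = {j}")
        case True
        then have "A j = {}" using False by auto
        then have "M j = 1" by (simp add: M_def facet_monomial_empty)
        \<comment> \<open>The unit \<open>M j\<close> kills the homology, so there is none.\<close>
        then have "Z I i \<subseteq> B I i"
          using generator_kills_homology[OF I(1) j I(2)] by fastforce
        then have "Z I i = B I i" using B_subset_Z[OF I] by blast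
        then show ?thesis by (simp add: filtered_refl)
      next
        case not_single: False
        then obtain g where g: "g \<in> I" "g \<noteq> j" and joint: "\<And>l. l \<in> I \<Longrightarrow> l \<noteq> j \<Longrightarrow> A j \<inter> A l \<subseteq> A g"
          using leaf by blast
        have gq: "g < q" using g I by auto
        have sub: "A j \<subseteq> A g" using False joint by blast
        have Mg: "M g = facet_monomial (A g - A j) * M j"
          using facet_monomial_union[of "A g - A j" "A j", where 'a = 'k] finA[OF gq] finA[OF jq] sub
          by (simp add: M_def Un_absorb2 Int_commute)
        have c: "facet_monomial (A g - A j) \<in> (polys n :: 'k pl set)"
          using A[OF gq] by (intro facet_monomial_polys) auto
        \<comment> \<open>There is one generator fewer without \<open>g\<close>, so the pieces in
          degree \<open>a\<close> satisfy the bound for degree \<open>i\<close> as soon as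
          \<open>a\<close> is at least \<open>i - 1\<close>; this is used for \<open>i\<close> and
          \<open>i - 1\<close>.\<close>
        have f: "filtered fscale (polys n) (pieces n (\<Union>(A ` I)) (card I) i) (B (I - {g}) a) (Z (I - {g}) a)"
          if "i - 1 \<le> a" for a
          using that card_I[OF g(1)] by (intro filtered_mono[OF IH[OF g(1)]] pieces_mono) auto
        have "filtered fscale (polys n) (pieces n (\<Union>(A ` I)) (card I) i)
            (B (insert g (I - {g})) i) (Z (insert g (I - {g})) i)"
          by (rule filtered_redundant[OF _ _ _ _ c Mg f f]) (use I j g in auto)
        then show ?thesis unfolding ins[OF g(1)] .
      qed
    qed
  qed
  then show ?case unfolding M_def .
qed

section \<open>From filtrations to depth\<close>

lemma addms_snoc: "addms s N L (rs @ [r]) = addm s (addms s N L rs) r N"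
  by (induction rs arbitrary: L) auto

lemma gen_sub_eq_addms: "gen_sub N L rs = addms fscale N L rs"
proof (induction rs rule: rev_induct)
  case Nil
  show ?case by (simp add: gen_sub_def)
next
  case (snoc r rs)
  have "gen_sub N L (rs @ [r]) = addm fscale (gen_sub N L rs) r N"
  proof
    show "gen_sub N L (rs @ [r]) \<subseteq> addm fscale (gen_sub N L rs) r N"
    proof
      fix v assume "v \<in> gen_sub N L (rs @ [r])"
      then obtain l w where v: "v = (\<lambda>T. l T + (\<Sum>j<Suc (length rs). (rs @ [r]) ! j * w j T))"
        and lw: "l \<in> L" "\<forall>j<Suc (length rs). w j \<in> N"
        by (auto simp: gen_sub_def)
      define u where "u = (\<lambda>T. l T + (\<Sum>j<length rs. rs ! j * w j T))"
      have "u \<in> gen_sub N L rs" unfolding gen_sub_def u_def using lw less_Suc_eq by blast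
      moreover have "v = u + fscale r (w (length rs))"
        by (simp add: v u_def fscale_def fun_eq_iff nth_append add.assoc)
      ultimately show "v \<in> addm fscale (gen_sub N L rs) r N"
        unfolding addm_def using lw by blast
    qed
    show "addm fscale (gen_sub N L rs) r N \<subseteq> gen_sub N L (rs @ [r])"
    proof
      fix v assume "v \<in> addm fscale (gen_sub N L rs) r N"
      then obtain l w u where v: "v = (\<lambda>T. l T + (\<Sum>j<length rs. rs ! j * w j T)) + fscale r u"
        and lw: "l \<in> L" "\<forall>j<length rs. w j \<in> N" "u \<in> N"
        by (auto simp: gen_sub_def addm_def)
      define w' where "w' = w(length rs := u)"
      have "v = (\<lambda>T. l T + (\<Sum>j<length (rs @ [r]). (rs @ [r]) ! j * w' j T))"
        by (simp add: v w'_def fscale_def fun_eq_iff nth_append add.assoc)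
      moreover have "\<forall>j<length (rs @ [r]). w' j \<in> N" using lw by (auto simp: w'_def less_Suc_eq)
      ultimately show "v \<in> gen_sub N L (rs @ [r])" unfolding gen_sub_def using lw(1) by blast
    qed
  qed
  then show ?case by (simp add: snoc addms_snoc)
qed

lemma weakly_regular_nth:
  "weakly_regular s N L rs \<Longrightarrow> j < length rs \<Longrightarrow> regular_on s N (addms s N L (take j rs)) (rs ! j)"
proof (induction rs arbitrary: L j)
  case (Cons r rs)
  then show ?case by (cases j) auto
qed simp

lemma addms_subset:
  assumes "L \<subseteq> G" "\<And>u v. u \<in> G \<Longrightarrow> v \<in> G \<Longrightarrow> u + v \<in> G" "\<And>r v. r \<in> set rs \<Longrightarrow> v \<in> N \<Longrightarrow> s r v \<in> G"
  shows "addms s N L rs \<subseteq> G"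
  using assms
proof (induction rs arbitrary: L)
  case (Cons r rs)
  have "addm s L r N \<subseteq> G" unfolding addm_def using Cons.prems by auto
  then show ?case using Cons by simp
qed simp

lemma lookup_mult_zero:
  fixes r p :: "'k::field pl"
  assumes "Poly_Mapping.lookup r 0 = 0"
  shows "Poly_Mapping.lookup (r * p) 0 = 0"
proof (rule ccontr)
  assume "Poly_Mapping.lookup (r * p) 0 \<noteq> 0"
  then have "0 \<in> Poly_Mapping.keys (r * p)" by (simp add: in_keys_iff)
  then obtain a b where ab: "0 = a + b" "a \<in> Poly_Mapping.keys r"
    using Poly_Mapping.keys_mult[of r p] by blast
  then have "Poly_Mapping.keys a = {}" using keys_add_nat[of a b] by (metis Un_empty keys_zero)
  then have "a = 0" by simp
  then show False using ab(2) assms by (simp add: in_keys_iff)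
qed

text \<open>The elementary symmetric polynomials are weakly regular on all cyclic quotients, hence
  on \<open>N / L\<close>. If there is a last cyclic quotient, it stays nonzero after localization
  and modulo the sequence, as its annihilator lies in the maximal ideal.\<close>

lemma depth_ge_filtered:
  fixes N L :: "(nat set \<Rightarrow> 'k::field pl) set"
  assumes filt: "filtered fscale (polys n) \<J> L N" and L: "subm fscale (polys n) L"
    and \<J>: "\<And>J. J \<in> \<J> \<Longrightarrow> \<exists>S. J = var_ideal n S \<and> S \<subseteq> {..<n} \<and> d + card S \<le> n"
  shows "depth_ge n N L d"
  using filt
proof cases
  case filtered_refl
  have "sat n N N = N" unfolding sat_def
    by (auto simp: inPn_def unit_at0_def intro!: exI[of _ 1])
  then show ?thesis using filtered_refl by (simp add: depth_ge_def)
next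
  case (filtered_step K z)
  let ?rs = "map (esym n) [1..<Suc d] :: 'k pl list"
  have K: "subm fscale (polys n) K" by (rule fm.filtered_subm[OF filtered_step(2) L])
  have N: "subm fscale (polys n) N" by (rule fm.filtered_subm[OF filt L])
  have rs: "r \<in> polys n \<and> Poly_Mapping.lookup r 0 = 0" if "r \<in> set ?rs" for r
    using that by (auto intro!: esym_polys lookup_homog[OF homog_esym])
  have wreg: "weakly_regular fscale N L ?rs"
  proof (rule fm.filtered_weakly_regular[OF filt L])
    show "set ?rs \<subseteq> polys n" using rs by blast
    show "weakly_regular (*) (polys n) J ?rs" if "J \<in> \<J>" for J
      using \<J>[OF that] weakly_regular_esym by blast
  qed
  have "regular_seq n N L ?rs"
    unfolding regular_seq_def
  proof (intro conjI allI impI ballI)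
    fix j assume j: "j < length ?rs"
    then have "?rs ! j \<in> set ?rs" by (rule nth_mem)
    then show "inPn n (?rs ! j)" "Poly_Mapping.lookup (?rs ! j) 0 = 0"
      using rs by (auto simp only: polys_def mem_Collect_eq)
    let ?G = "gen_sub N L (take j ?rs)"
    fix v assume v: "v \<in> N" and "(\<lambda>T. ?rs ! j * v T) \<in> sat n N ?G"
    then obtain s where s: "inPn n s" "unit_at0 s" "(\<lambda>T. s * (?rs ! j * v T)) \<in> ?G"
      by (auto simp only: sat_def mem_Collect_eq)
    \<comment> \<open>Weak regularity passes to the localization by moving the denominator
      \<open>s\<close> to \<open>v\<close>.\<close>
    have "fscale (?rs ! j) (fscale s v) = (\<lambda>T. s * (?rs ! j * v T))"
      unfolding fscale_def by (intro ext) (rule mult.left_commute)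
    then have "fscale (?rs ! j) (fscale s v) \<in> ?G" using s(3) by simp
    moreover have "fscale s v \<in> N" using s(1) v by (intro fm.subm_scale[OF N]) (simp add: polys_def)
    ultimately have "fscale s v \<in> ?G"
      using weakly_regular_nth[OF wreg j] unfolding gen_sub_eq_addms regular_on_def by blast
    then show "v \<in> sat n N ?G" unfolding sat_def using s v by (auto simp: fscale_def)
  next
    show "sat n N (gen_sub N L ?rs) \<noteq> N"
    proof
      assume eq: "sat n N (gen_sub N L ?rs) = N"
      \<comment> \<open>\<open>?G\<close> is \<open>K\<close> plus the maximal ideal times
        \<open>z\<close>, and it contains the submodule generated by \<open>L\<close> and the
        sequence. If it contained \<open>fscale s z\<close> with \<open>s\<close> a unit at 0, an
        element with nonzero constant term would annihilate \<open>z\<close> modulo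
        \<open>K\<close>.\<close>
      let ?G = "{k + fscale p z | k p. k \<in> K \<and> p \<in> polys n \<and> Poly_Mapping.lookup p 0 = 0}"
      have GI: "k + fscale p z \<in> ?G"
        if "k \<in> K" "p \<in> polys n" "Poly_Mapping.lookup p 0 = 0" for k p
        using that unfolding mem_Collect_eq by (intro exI[of _ k] exI[of _ p] conjI refl)
      have "z \<in> N" unfolding filtered_step(1) by (rule fm.cyc_generator[OF K])
      then have "z \<in> sat n N (gen_sub N L ?rs)" using eq by simp
      then obtain s where s: "inPn n s" "unit_at0 s" "fscale s z \<in> addms fscale N L ?rs"
        unfolding gen_sub_eq_addms by (auto simp: sat_def fscale_def)
      have "addms fscale N L ?rs \<subseteq> ?G"
      proof (rule addms_subset)
        show "L \<subseteq> ?G"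
        proof
          fix l assume "l \<in> L"
          then have "l \<in> K" by (rule subsetD[OF fm.filtered_subset[OF filtered_step(2)]])
          then show "l \<in> ?G"
            using GI[of l 0] by (simp only: polys.R_zero lookup_zero fm.scale_zero_left add_0_right)
        qed
        fix u v assume "u \<in> ?G" "v \<in> ?G"
        then obtain k p k' p' where "u = k + fscale p z" "v = k' + fscale p' z"
          and kp: "k \<in> K" "k' \<in> K" "p \<in> polys n" "p' \<in> polys n"
            "Poly_Mapping.lookup p 0 = 0" "Poly_Mapping.lookup p' 0 = 0" by blast
        then have "u + v = (k + k') + fscale (p + p') z" by (simp add: fm.scale_left_distrib)
        moreover have "k + k' \<in> K" "p + p' \<in> polys n" "Poly_Mapping.lookup (p + p') 0 = 0"
          using kp by (auto intro: fm.subm_add[OF K] polys.R_add simp: lookup_add)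
        ultimately show "u + v \<in> ?G" using GI by (simp only:)
      next
        fix r v assume r: "r \<in> set ?rs" and "v \<in> N"
        then obtain k p where v: "v = k + fscale p z" "k \<in> K" "p \<in> polys n"
          unfolding filtered_step(1) cyc_def by blast
        then have "fscale r v = fscale r k + fscale (r * p) z" by (simp add: fm.scale_right_distrib)
        moreover have "fscale r k \<in> K" "r * p \<in> polys n" "Poly_Mapping.lookup (r * p) 0 = 0"
          using rs[OF r] v by (auto intro: fm.subm_scale[OF K] polys.R_mult lookup_mult_zero)
        ultimately show "fscale r v \<in> ?G" using GI by (simp only:)
      qed
      then obtain k p where kp: "fscale s z = k + fscale p z" "k \<in> K" "p \<in> polys n"
        "Poly_Mapping.lookup p 0 = 0" using s(3) by blast
      then have "fscale (s - p) z = k" by (simp add: fm.scale_left_diff_distrib)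
      then have "s - p \<in> {p \<in> polys n. fscale p z \<in> K}"
        using kp polys.R_diff[of s n p] s(1) by (simp add: polys_def)
      moreover obtain S where "{p \<in> polys n. fscale p z \<in> K} = var_ideal n S"
        using \<J>[OF filtered_step(3)] by blast
      ultimately have "s - p \<in> var_ideal n S" by simp
      then have "Poly_Mapping.lookup (s - p) 0 = 0" by (rule lookup_var_ideal)
      then show False using kp(4) s(2) by (simp add: lookup_minus unit_at0_def)
    qed
  qed
  moreover have "length ?rs = d" by simp
  ultimately show ?thesis unfolding depth_ge_def by blast
qed

section \<open>Sliding depth for trees\<close>

lemma cycles_eq: "cycles n M q i = kcycles n q M {..<q} (int i)"
  unfolding cycles_def kcycles_def chains_def kchains_def polys_def zero_fun_def by auto

lemma boundaries_eq: "boundaries n M q i = kbounds n q M {..<q} (int i)"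
proof -
  have "chains n q (Suc i) = (kchains n {..<q} (int i + 1) :: (nat set \<Rightarrow> 'a pl) set)"
    unfolding chains_def kchains_def polys_def by auto
  then show ?thesis by (simp add: boundaries_def kbounds_def)
qed

theorem mainTheorem1:
  fixes n :: nat and F :: "nat set set" and fs :: "nat set list"
  assumes "facet_set n F" and "is_tree F" and "distinct fs" and "set fs = F"
  shows "\<forall>i. depth_ge n
            (cycles n (\<lambda>j. (facet_monomial (fs ! j) :: 'k::field pl)) (length fs) i)
            (boundaries n (\<lambda>j. (facet_monomial (fs ! j) :: 'k::field pl)) (length fs) i)
            (nat (int n - int (length fs) + int i))"
proof
  fix i
  define q where "q = length fs"
  have fs: "fs ! l \<subseteq> {..<n}" if "l < q" for l
    using that assms(1,4) nth_mem[of l fs] unfolding facet_set_def q_def by blast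
  have inj: "l = l'" if "fs ! l = fs ! l'" "l < q" "l' < q" for l l'
    using that assms(3) by (simp add: nth_eq_iff_index_eq q_def)
  have leaf: "leaf_family ((!) fs) {..<q}"
    unfolding leaf_family_def
  proof (intro allI impI)
    fix J assume J: "J \<subseteq> {..<q} \<and> J \<noteq> {}"
    let ?G = "(!) fs ` J"
    have "?G \<subseteq> F \<and> ?G \<noteq> {}" using J assms(4) unfolding q_def by auto
    then obtain X where "is_leaf ?G X" using assms(2) unfolding is_tree_def by blast
    then have X: "X \<in> ?G" "?G = {X} \<or> (\<exists>Y\<in>?G. Y \<noteq> X \<and> (\<forall>C\<in>?G. C \<noteq> X \<longrightarrow> X \<inter> C \<subseteq> X \<inter> Y))"
      unfolding is_leaf_def by simp_all
    then obtain j where j: "j \<in> J" "X = fs ! j" by blast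
    \<comment> \<open>Distinct indices carry distinct facets, so a leaf of the subcomplex is a leaf
      among the indices.\<close>
    have ne: "fs ! l \<noteq> fs ! j" if "l \<in> J" "l \<noteq> j" for l using that j(1) J inj[of l j] by blast
    from X(2)[unfolded j(2)] have "J = {j} \<or> (\<exists>g\<in>J. g \<noteq> j \<and> (\<forall>l\<in>J. l \<noteq> j \<longrightarrow> fs ! j \<inter> fs ! l \<subseteq> fs ! g))"
    proof
      assume "?G = {fs ! j}"
      then have "fs ! l = fs ! j" if "l \<in> J" for l using that by blast
      then have "J = {j}" using ne j(1) by blast
      then show ?thesis ..
    next
      assume "\<exists>Y\<in>?G. Y \<noteq> fs ! j \<and> (\<forall>C\<in>?G. C \<noteq> fs ! j \<longrightarrow> fs ! j \<inter> C \<subseteq> fs ! j \<inter> Y)"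
      then obtain g where g: "g \<in> J" "fs ! g \<noteq> fs ! j"
        "\<forall>C\<in>?G. C \<noteq> fs ! j \<longrightarrow> fs ! j \<inter> C \<subseteq> fs ! j \<inter> fs ! g" by (elim bexE conjE imageE) simp
      have "fs ! j \<inter> fs ! l \<subseteq> fs ! g" if "l \<in> J" "l \<noteq> j" for l
        using g(3) ne[OF that] that(1) by simp
      moreover have "g \<noteq> j" using g(2) by blast
      ultimately show ?thesis using g(1) by (intro disjI2 bexI[of _ g]) simp_all
    qed
    then show "\<exists>j\<in>J. J = {j} \<or> (\<exists>g\<in>J. g \<noteq> j \<and> (\<forall>l\<in>J. l \<noteq> j \<longrightarrow> fs ! j \<inter> fs ! l \<subseteq> fs ! g))"
      by (rule bexI[OF _ j(1)])
  qed
  have filt: "filtered fscale (polys n) (pieces n (\<Union>((!) fs ` {..<q})) (card {..<q}) (int i))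
      (kbounds n q (\<lambda>l. facet_monomial (fs ! l) :: 'k pl) {..<q} (int i))
      (kcycles n q (\<lambda>l. facet_monomial (fs ! l)) {..<q} (int i))"
    by (rule koszul_filtered[OF finite_lessThan subset_refl fs leaf])
  have M: "koszul n q (\<lambda>l. facet_monomial (fs ! l) :: 'k pl)"
    by standard (use fs in \<open>simp add: facet_monomial_polys\<close>)
  show "depth_ge n
            (cycles n (\<lambda>j. (facet_monomial (fs ! j) :: 'k::field pl)) (length fs) i)
            (boundaries n (\<lambda>j. (facet_monomial (fs ! j) :: 'k::field pl)) (length fs) i)
            (nat (int n - int (length fs) + int i))"
    unfolding cycles_eq boundaries_eq q_def[symmetric]
  proof (rule depth_ge_filtered[OF filt koszul.subm_B[OF M]])
    fix J :: "'k pl set" assume "J \<in> pieces n (\<Union>((!) fs ` {..<q})) (card {..<q}) (int i)"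
    then obtain S where S: "J = var_ideal n S" "S \<subseteq> \<Union>((!) fs ` {..<q})" "int (card S) + int i \<le> int q"
      by (auto simp: pieces_def)
    have Sn: "S \<subseteq> {..<n}" using S(2) fs by blast
    \<comment> \<open>This settles the case where \<open>n - q + i\<close> is negative and
      \<open>nat\<close> turns the bound into 0.\<close>
    then have "card S \<le> n" using card_mono[of "{..<n}" S] by simp
    then have "nat (int n - int q + int i) + card S \<le> n" using S(3) by linarith
    then show "\<exists>S. J = var_ideal n S \<and> S \<subseteq> {..<n} \<and> nat (int n - int q + int i) + card S \<le> n"
      using S(1) Sn by blast
  qed
qed

end
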